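(* Let $k$ be an algebraically closed field, let $n\geq 3$, and let $\Gamma$ be a set of $n+2$ distinct points in general linear position in $\mathbb{P}^n=\mathbb{P}^n_k$. Let $J\subset R=k[x_0,\ldots,x_n]$ be the homogeneous defining ideal of $\Gamma$, let $\Theta$ be the Jacobian matrix of a minimal set of homogeneous generators of $J$, let $I_n(\Theta)$ be the ideal of $R$ generated by the $n\times n$ minors of $\Theta$, and let $\mathfrak{m}=(x_0,\ldots,x_n)$. Then $I_n(\Theta)=\mathfrak{m}^n$; in particular, the pair $J\subset (J,I_n(\Theta))$ is torsion-free.
   Context: $R=k[x_0,\ldots,x_n]$ is the standard graded polynomial ring. The defining ideal of a finite set of points $\Gamma\subset\mathbb{P}^n_k$ is $J=\bigcap_{p\in\Gamma} I(p)$, where $I(p)$ is the homogeneous prime ideal of $p$. A set of $s$ distinct points of $\mathbb{P}^n$ is in general linear position if either $s\leq n$ and the points span a $\mathbb{P}^{s-1}$, or $s\geq n+1$ and no subset of $n+1$ of the points is contained in a hyperplane of $\mathbb{P}^n$. A pair of ideals $J\subset I$ of $R$ is called (Aluffi) torsion-free if its Valabrega--Valla module $\bigoplus_{t\geq 2}\frac{J\cap I^t}{JI^{t-1}}$ is zero, i.e. if $J\cap I^t=JI^{t-1}$ for every $t\geq 2$. *)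

theory Defs
  imports
    "HOL-Analysis.Analysis"
    "HOL-Library.Poly_Mapping"
    "Jordan_Normal_Form.Determinant"
begin

section \<open>Polynomials in finitely many variables\<close>

text \<open>
  The variables are indexed by a finite type \<open>'v\<close>, so that \<open>k[x\<^sub>0,\<dots>,x\<^sub>n]\<close> is the type
  \<open>('v, 'a) mpoly\<close> with \<open>CARD('v) = n + 1\<close>. A polynomial maps each exponent vector to its
  coefficient; the ring structure (convolution product) is that of \<^theory>\<open>HOL-Library.Poly_Mapping\<close>.
\<close>

type_synonym ('v, 'a) mpoly = "('v \<Rightarrow>\<^sub>0 nat) \<Rightarrow>\<^sub>0 'a"

definition Var :: "'v \<Rightarrow> ('v, 'a::comm_ring_1) mpoly" where
  "Var i = Poly_Mapping.single (Poly_Mapping.single i 1) 1"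

definition mdeg :: "('v::finite \<Rightarrow>\<^sub>0 nat) \<Rightarrow> nat" where
  "mdeg m = (\<Sum>i\<in>UNIV. Poly_Mapping.lookup m i)"

text \<open>The zero polynomial counts as homogeneous.\<close>

definition homogeneous :: "('v::finite, 'a::comm_ring_1) mpoly \<Rightarrow> bool" where
  "homogeneous f \<longleftrightarrow> (\<exists>d. \<forall>m\<in>Poly_Mapping.keys f. mdeg m = d)"

definition eval_mpoly :: "('v::finite, 'a::comm_ring_1) mpoly \<Rightarrow> 'a ^ 'v \<Rightarrow> 'a" where
  "eval_mpoly f v =
     (\<Sum>m\<in>Poly_Mapping.keys f. Poly_Mapping.lookup f m *
        (\<Prod>i\<in>UNIV. vec_nth v i ^ Poly_Mapping.lookup m i))"

text \<open>
  If \<open>x\<^sub>i\<close> does not occur in the monomial \<open>m\<close>, the truncated difference of exponents below is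
  meaningless, but the coefficient is then \<open>0\<close>.
\<close>

definition partial_deriv :: "'v \<Rightarrow> ('v, 'a::comm_ring_1) mpoly \<Rightarrow> ('v, 'a) mpoly" where
  "partial_deriv i f =
     (\<Sum>m\<in>Poly_Mapping.keys f.
        Poly_Mapping.single (m - Poly_Mapping.single i 1)
          (of_nat (Poly_Mapping.lookup m i) * Poly_Mapping.lookup f m))"


section \<open>Ideals of a commutative ring\<close>

text \<open>
  Ideals are the submodules of the ring over itself: \<open>ideal.subspace I\<close> says that \<open>I\<close> is an
  ideal, and \<open>ideal.span S\<close> is the ideal generated by \<open>S\<close>.
\<close>

global_interpretation ideal: Modules.module "(*) :: 'r::comm_ring_1 \<Rightarrow> 'r \<Rightarrow> 'r"
  by unfold_locales (simp_all add: algebra_simps)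

definition ideal_mult :: "'r::comm_ring_1 set \<Rightarrow> 'r set \<Rightarrow> 'r set" where
  "ideal_mult I J = ideal.span {a * b | a b. a \<in> I \<and> b \<in> J}"

primrec ideal_power :: "'r::comm_ring_1 set \<Rightarrow> nat \<Rightarrow> 'r set" where
  "ideal_power I 0 = UNIV"
| "ideal_power I (Suc t) = ideal_mult I (ideal_power I t)"

text \<open>
  The degree \<open>t\<close> component of the Valabrega--Valla module is the quotient of \<open>J \<inter> I\<^sup>t\<close> by its
  subideal \<open>J I\<^sup>t\<^sup>-\<^sup>1\<close>.
\<close>

definition aluffi_torsion_free :: "'r::comm_ring_1 set \<Rightarrow> 'r set \<Rightarrow> bool" where
  "aluffi_torsion_free J I \<longleftrightarrow>
     ideal.subspace J \<and> ideal.subspace I \<and> J \<subseteq> I \<and>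
     (\<forall>t\<ge>2. J \<inter> ideal_power I t = ideal_mult J (ideal_power I (t - 1)))"

definition irrelevant_ideal :: "('v, 'a::comm_ring_1) mpoly set" where
  "irrelevant_ideal = ideal.span (range Var)"

definition minimal_homogeneous_generators ::
    "('v::finite, 'a::comm_ring_1) mpoly set \<Rightarrow> ('v, 'a) mpoly set \<Rightarrow> bool" where
  "minimal_homogeneous_generators G J \<longleftrightarrow>
     finite G \<and> (\<forall>g\<in>G. homogeneous g) \<and> ideal.span G = J \<and>
     (\<forall>H. H \<subset> G \<longrightarrow> ideal.span H \<noteq> J)"


section \<open>Determinantal ideals\<close>

text \<open>
  A matrix with rows indexed by \<open>A\<close> and columns indexed by \<open>B\<close> is a function \<open>M\<close> on \<open>A \<times> B\<close>.
  The index sets carry no order, so an \<open>r \<times> r\<close> submatrix is selected by listing \<open>r\<close> distinct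
  rows and \<open>r\<close> distinct columns in any order. Reordering only changes the sign of the minor.
\<close>

definition minors :: "nat \<Rightarrow> 'i set \<Rightarrow> 'j set \<Rightarrow> ('i \<Rightarrow> 'j \<Rightarrow> 'r::comm_ring_1) \<Rightarrow> 'r set" where
  "minors r A B M =
     {Determinant.det (Matrix.mat r r (\<lambda>(i, j). M (rs ! i) (cs ! j))) | rs cs.
        distinct rs \<and> length rs = r \<and> set rs \<subseteq> A \<and>
        distinct cs \<and> length cs = r \<and> set cs \<subseteq> B}"

definition minors_ideal :: "nat \<Rightarrow> 'i set \<Rightarrow> 'j set \<Rightarrow> ('i \<Rightarrow> 'j \<Rightarrow> 'r::comm_ring_1) \<Rightarrow> 'r set" where
  "minors_ideal r A B M = ideal.span (minors r A B M)"

text \<open>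
  The Jacobian matrix of a set \<open>G\<close> of polynomials has a row for each \<open>g \<in> G\<close> and a column for
  each variable.
\<close>

definition jacobian_minors_ideal ::
    "nat \<Rightarrow> ('v::finite, 'a::comm_ring_1) mpoly set \<Rightarrow> ('v, 'a) mpoly set" where
  "jacobian_minors_ideal r G = minors_ideal r G UNIV (\<lambda>g i. partial_deriv i g)"


section \<open>Points of projective space\<close>

text \<open>A point of \<open>\<P>\<^sup>n\<close> is a line through the origin of \<open>k\<^sup>n\<^sup>+\<^sup>1\<close>, given as a set of vectors.\<close>

definition projective_points :: "('a::field ^ 'v::finite) set set" where
  "projective_points = {vec.span {v} | v. v \<noteq> 0}"

text \<open>A hyperplane of \<open>\<P>\<^sup>n\<close> is given by a linear hyperplane of \<open>k\<^sup>n\<^sup>+\<^sup>1\<close>.\<close>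

definition hyperplane :: "('a::field ^ 'v::finite) set \<Rightarrow> bool" where
  "hyperplane H \<longleftrightarrow> vec.subspace H \<and> vec.dim H = CARD('v) - 1"

text \<open>
  With \<open>CARD('v) = n + 1\<close>, the two alternatives are \<open>s \<le> n\<close> and \<open>s \<ge> n + 1\<close>; the points span a
  \<open>\<P>\<^sup>s\<^sup>-\<^sup>1\<close> when the lines span a linear subspace of dimension \<open>s\<close>.
\<close>

definition general_linear_position :: "('a::field ^ 'v::finite) set set \<Rightarrow> bool" where
  "general_linear_position \<Gamma> \<longleftrightarrow>
     \<Gamma> \<subseteq> projective_points \<and> finite \<Gamma> \<and>
     (card \<Gamma> < CARD('v) \<and> vec.dim (vec.span (\<Union>\<Gamma>)) = card \<Gamma> \<or>
      card \<Gamma> \<ge> CARD('v) \<and>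
        (\<forall>\<Delta>\<subseteq>\<Gamma>. card \<Delta> = CARD('v) \<longrightarrow> \<not> (\<exists>H. hyperplane H \<and> (\<forall>p\<in>\<Delta>. p \<subseteq> H))))"

definition point_ideal :: "('a::field ^ 'v::finite) set \<Rightarrow> ('v, 'a) mpoly set" where
  "point_ideal p = ideal.span {f. homogeneous f \<and> (\<forall>v\<in>p. eval_mpoly f v = 0)}"

definition defining_ideal :: "('a::field ^ 'v::finite) set set \<Rightarrow> ('v, 'a) mpoly set" where
  "defining_ideal \<Gamma> = (\<Inter>p\<in>\<Gamma>. point_ideal p)"

end

theory Submission
  imports Defs
begin

text \<open>
  Choose representatives \<open>b\<^sub>0, \<dots>, b\<^sub>n\<close> of \<open>n + 1\<close> of the points such that their sum represents the last
  one, and let \<open>L\<^sub>0, \<dots>, L\<^sub>n\<close> be the dual linear forms (\<open>general_linear_position_frame\<close>). In these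
  coordinates the points are the coordinate points and the unit point, so the ideal \<open>J\<close> contains all
  quadrics \<open>L\<^sub>i L\<^sub>j - L\<^sub>k L\<^sub>m\<close> with \<open>i \<noteq> j\<close> and \<open>k \<noteq> m\<close>. Modulo these quadrics all monomials of degree \<open>d\<close>
  that involve at least two of the \<open>L\<^sub>i\<close> coincide. A form of degree \<open>d\<close> that vanishes at the coordinate
  points involves no power \<open>L\<^sub>i\<^sup>d\<close>, and if it also vanishes at the unit point its coefficients sum to
  zero. Hence \<open>J\<close> starts in degree two and its part of degree \<open>d\<close> lies in \<open>J \<mm>\<^sup>d\<^sup>-\<^sup>2\<close>
  (\<open>homogeneous_in_J\<close>).

  The entries of the Jacobian matrix thus have no constant term, and \<open>I\<^sub>n(\<Theta>) \<subseteq> \<mm>\<^sup>n\<close>. For the reverse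
  inclusion, the quadrics of \<open>J\<close> are combinations of the generators with constant coefficients, so it
  suffices to consider the minors of the gradients of the \<open>L\<^sub>i L\<^sub>j - L\<^sub>k L\<^sub>m\<close>, written in the coordinates
  \<open>L\<^sub>i\<close>: the vectors \<open>(x\<^sub>i e\<^sub>j + x\<^sub>j e\<^sub>i) - (x\<^sub>k e\<^sub>m + x\<^sub>m e\<^sub>k)\<close> with \<open>x = L\<close>. That these minors generate all
  monomials of degree \<open>n\<close> holds over any commutative ring, by induction on the number of
  variables (\<open>monomials_from_difference_row_minors\<close>): a monomial of degree \<open>n\<close> in \<open>n + 1\<close> variables
  omits one of them, and splitting off a suitable row and the column of the omitted variable
  reduces to one variable less. The induction starts with explicit \<open>3 \<times> 3\<close> minors in four variables.

  Torsion-freeness is then formal (\<open>aluffi_torsion_free_add_power\<close>). For \<open>I = J + \<mm>\<^sup>n\<close> one has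
  \<open>I\<^sup>t \<subseteq> J I\<^sup>t\<^sup>-\<^sup>1 + \<mm>\<^sup>n\<^sup>t\<close>, and \<open>J \<inter> \<mm>\<^sup>n\<^sup>t \<subseteq> J \<mm>\<^sup>n\<^sup>t\<^sup>-\<^sup>2 \<subseteq> J I\<^sup>t\<^sup>-\<^sup>1\<close> because \<open>J\<close> is generated by quadrics.
\<close>

(* The dollar sign denotes coordinates of vectors indexed by a finite type throughout. *)
no_notation Matrix.vec_index (infixl "$" 100)

(* For ideals this rule is associativity, oriented against mult.assoc. *)
declare ideal.scale_scale [simp del]

section \<open>Determinants\<close>

text \<open>
  Entries given by a function make submatrices with repeated, reordered or combined rows plain
  function composition.
\<close>

definition det_of :: "nat \<Rightarrow> (nat \<Rightarrow> nat \<Rightarrow> 'r::comm_ring_1) \<Rightarrow> 'r" where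
  "det_of m f = Determinant.det (Matrix.mat m m (\<lambda>(i, j). f i j))"

lemma det_of_cong:
  "(\<And>i j. i < m \<Longrightarrow> j < m \<Longrightarrow> f i j = g i j) \<Longrightarrow> det_of m f = det_of m g"
  unfolding det_of_def by (rule arg_cong[where f = Determinant.det]) (rule eq_matI, auto)

lemma det_of_transpose: "det_of m (\<lambda>i j. f j i) = det_of m f"
proof -
  have "Matrix.mat m m (\<lambda>(i, j). f j i) = transpose_mat (Matrix.mat m m (\<lambda>(i, j). f i j))"
    by (rule eq_matI) auto
  thus ?thesis
    unfolding det_of_def using Determinant.det_transpose[of "Matrix.mat m m (\<lambda>(i, j). f i j)" m] by simp
qed

lemma det_of_equal_rows:
  assumes "i < m" "i' < m" "i \<noteq> i'" "\<And>j. j < m \<Longrightarrow> f i j = f i' j"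
  shows "det_of m f = 0"
  unfolding det_of_def
  by (rule Determinant.det_identical_rows[of _ m i i']) (use assms in \<open>auto intro!: eq_vecI\<close>)

lemma det_of_row_sum:
  assumes "k < m"
  shows "det_of m (\<lambda>i j. if i = k then (\<Sum>s\<in>F. c s * h s j) else f i j)
       = (\<Sum>s\<in>F. c s * det_of m (\<lambda>i j. if i = k then h s j else f i j))"
proof -
  let ?M = "\<lambda>r. Matrix.mat m m (\<lambda>(i, j). if i = k then r j else f i j)"
  have expand: "Determinant.det (?M r) = (\<Sum>j<m. r j * cofactor (?M (\<lambda>_. 0)) k j)" for r
  proof -
    have "mat_delete (?M r) k j = mat_delete (?M (\<lambda>_. 0)) k j" for j
      by (rule eq_matI) (auto simp: mat_delete_def)
    hence "cofactor (?M r) k j = cofactor (?M (\<lambda>_. 0)) k j" for j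
      by (simp add: cofactor_def)
    thus ?thesis
      using laplace_expansion_row[of "?M r" m k] assms by (auto intro: sum.cong)
  qed
  show ?thesis
    unfolding det_of_def expand sum_distrib_left sum_distrib_right mult.assoc by (rule sum.swap)
qed

lemma det_of_Suc_first_column:
  assumes "\<And>i. i < m \<Longrightarrow> f (Suc i) 0 = 0"
  shows "det_of (Suc m) f = f 0 0 * det_of m (\<lambda>i j. f (Suc i) (Suc j))"
proof -
  let ?M = "Matrix.mat (Suc m) (Suc m) (\<lambda>(i, j). f i j)"
  have "Determinant.det ?M = (\<Sum>i<Suc m. ?M $$ (i, 0) * cofactor ?M i 0)"
    by (rule laplace_expansion_column) auto
  also have "\<dots> = f 0 0 * cofactor ?M 0 0"
    using assms by (subst sum.lessThan_Suc_shift) simp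
  also have "mat_delete ?M 0 0 = Matrix.mat m m (\<lambda>(i, j). f (Suc i) (Suc j))"
    by (rule eq_matI) (auto simp: mat_delete_def)
  hence "cofactor ?M 0 0 = det_of m (\<lambda>i j. f (Suc i) (Suc j))"
    by (simp add: cofactor_def det_of_def)
  finally show ?thesis by (simp add: det_of_def)
qed

lemma det_of_Suc:
  "det_of (Suc m) f = (\<Sum>k<Suc m. (-1) ^ k * f 0 k *
     det_of m (\<lambda>i j. f (Suc i) (if j < k then j else Suc j)))"
proof -
  let ?M = "Matrix.mat (Suc m) (Suc m) (\<lambda>(i, j). f i j)"
  have "Determinant.det ?M = (\<Sum>j<Suc m. ?M $$ (0, j) * cofactor ?M 0 j)"
    by (rule laplace_expansion_row) auto
  also have "\<dots> = (\<Sum>k<Suc m. (-1) ^ k * f 0 k *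
     det_of m (\<lambda>i j. f (Suc i) (if j < k then j else Suc j)))"
  proof (rule sum.cong[OF refl])
    fix k assume k: "k \<in> {..<Suc m}"
    have "mat_delete ?M 0 k = Matrix.mat m m (\<lambda>(i, j). f (Suc i) (if j < k then j else Suc j))"
      by (rule eq_matI) (auto simp: mat_delete_def)
    thus "?M $$ (0, k) * cofactor ?M 0 k = (-1) ^ k * f 0 k *
       det_of m (\<lambda>i j. f (Suc i) (if j < k then j else Suc j))"
      using k by (simp add: cofactor_def det_of_def)
  qed
  finally show ?thesis by (simp add: det_of_def)
qed

lemma det_of_0: "det_of 0 f = 1"
  unfolding det_of_def by (rule det_dim_zero) auto

lemma det_of_1: "det_of (Suc 0) f = f 0 0"
  by (simp add: det_of_Suc det_of_0)

lemma det_of_2: "det_of 2 f = f 0 0 * f 1 1 - f 0 1 * f 1 0"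
  unfolding numeral_2_eq_2 by (simp add: det_of_Suc[of "Suc 0"] det_of_1)

lemma det_of_3:
  "det_of 3 f = f 0 0 * (f 1 1 * f 2 2 - f 1 2 * f 2 1)
              - f 0 1 * (f 1 0 * f 2 2 - f 1 2 * f 2 0)
              + f 0 2 * (f 1 0 * f 2 1 - f 1 1 * f 2 0)"
proof -
  have "det_of 3 f = (\<Sum>k<3. (-1) ^ k * f 0 k *
     det_of 2 (\<lambda>i j. f (Suc i) (if j < k then j else Suc j)))"
    using det_of_Suc[of 2 f] by simp
  thus ?thesis
    by (simp add: lessThan_Suc numeral_3_eq_3 det_of_2) (simp add: eval_nat_numeral)
qed

text \<open>
  Multilinearity: expand one row after the other. The rows below \<open>k\<close> are already replaced by
  combinations of the \<open>h s\<close>, the others are still single vectors \<open>h (\<sigma> i)\<close>.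
\<close>

lemma det_of_combined_rows_in_ideal:
  assumes I: "ideal.subspace I" and "finite F"
    and f: "\<And>i j. i < m \<Longrightarrow> j < m \<Longrightarrow> f i j = (\<Sum>s\<in>F. c i s * h s j)"
    and dets: "\<And>\<sigma>. (\<And>i. i < m \<Longrightarrow> \<sigma> i \<in> F) \<Longrightarrow> det_of m (\<lambda>i. h (\<sigma> i)) \<in> I"
  shows "det_of m f \<in> I"
proof -
  have partial: "det_of m (\<lambda>i j. if i < k then f i j else h (\<sigma> i) j) \<in> I"
    if "k \<le> m" "\<And>i. i < m \<Longrightarrow> \<sigma> i \<in> F" for k \<sigma>
    using that
  proof (induction k arbitrary: \<sigma>)
    case 0
    thus ?case using dets[of \<sigma>] by simp
  next
    case (Suc k)
    hence k: "k < m" by simp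
    have "det_of m (\<lambda>i j. if i < Suc k then f i j else h (\<sigma> i) j) =
          det_of m (\<lambda>i j. if i = k then (\<Sum>s\<in>F. c k s * h s j) else if i < k then f i j else h (\<sigma> i) j)"
      by (rule det_of_cong) (auto simp: f less_Suc_eq)
    also have "\<dots> = (\<Sum>s\<in>F. c k s *
        det_of m (\<lambda>i j. if i = k then h s j else if i < k then f i j else h (\<sigma> i) j))"
      by (rule det_of_row_sum[OF k])
    also have "\<dots> \<in> I"
    proof (rule ideal.subspace_sum[OF I], rule ideal.subspace_scale[OF I])
      fix s assume s: "s \<in> F"
      have "det_of m (\<lambda>i j. if i = k then h s j else if i < k then f i j else h (\<sigma> i) j)
          = det_of m (\<lambda>i j. if i < k then f i j else h ((\<sigma>(k := s)) i) j)"
        by (rule det_of_cong) auto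
      also have "\<dots> \<in> I"
        using Suc s by (intro Suc.IH) auto
      finally show "det_of m (\<lambda>i j. if i = k then h s j else if i < k then f i j else h (\<sigma> i) j) \<in> I" .
    qed
    finally show ?case .
  qed
  \<comment> \<open>Without any vectors \<open>h s\<close> there is no \<open>\<sigma>\<close> to start from.\<close>
  show ?thesis
  proof (cases "F = {}")
    case True
    show ?thesis
    proof (cases "m = 0")
      case True
      thus ?thesis using dets[of undefined] by (simp add: det_of_0)
    next
      case False
      hence "det_of m f = det_of m (\<lambda>i j. if i = 0 then (\<Sum>s\<in>F. c i s * h s j) else f i j)"
        by (intro det_of_cong) (auto simp: f)
      also have "\<dots> = 0"
        using det_of_row_sum[of 0 m "c 0" h F f] False True by (simp cong: if_cong)
      finally show ?thesis using I by (simp add: ideal.subspace_0)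
    qed
  next
    case False
    hence "(SOME s. s \<in> F) \<in> F" by (simp add: some_in_eq)
    have "det_of m f = det_of m (\<lambda>i j. if i < m then f i j else h (SOME s. s \<in> F) j)"
      by (rule det_of_cong) auto
    also have "\<dots> \<in> I"
      using \<open>(SOME s. s \<in> F) \<in> F\<close> by (intro partial) auto
    finally show ?thesis .
  qed
qed

text \<open>
  The generating minors use distinct rows and columns; a repetition only adds a zero determinant.
\<close>

lemma det_of_in_minors_ideal:
  assumes "\<And>i. i < m \<Longrightarrow> rs i \<in> A" "\<And>j. j < m \<Longrightarrow> cs j \<in> B"
  shows "det_of m (\<lambda>i j. M (rs i) (cs j)) \<in> minors_ideal m A B M"
proof -
  consider "inj_on rs {..<m}" "inj_on cs {..<m}"
    | i i' where "i < m" "i' < m" "i \<noteq> i'" "rs i = rs i'"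
    | i i' where "i < m" "i' < m" "i \<noteq> i'" "cs i = cs i'"
    unfolding inj_on_def by blast
  thus ?thesis
  proof cases
    case 1
    have "det_of m (\<lambda>i j. M (rs i) (cs j)) = Determinant.det (Matrix.mat m m
       (\<lambda>(i, j). M (map rs [0..<m] ! i) (map cs [0..<m] ! j)))"
      unfolding det_of_def by (rule arg_cong[where f = Determinant.det]) (rule eq_matI, auto)
    moreover have "distinct (map rs [0..<m])" "distinct (map cs [0..<m])"
      using 1 by (auto simp: distinct_map atLeast0LessThan)
    ultimately have "det_of m (\<lambda>i j. M (rs i) (cs j)) \<in> minors m A B M"
      unfolding minors_def using assms
      by (intro CollectI exI[of _ "map rs [0..<m]"] exI[of _ "map cs [0..<m]"]) auto
    thus ?thesis by (simp add: minors_ideal_def ideal.span_base)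
  next
    case 2
    hence "det_of m (\<lambda>i j. M (rs i) (cs j)) = 0"
      by (intro det_of_equal_rows[of i m i']) auto
    thus ?thesis by (simp add: minors_ideal_def ideal.span_zero)
  next
    case 3
    hence "det_of m (\<lambda>j i. M (rs i) (cs j)) = 0"
      by (intro det_of_equal_rows[of i m i']) auto
    thus ?thesis
      using det_of_transpose[of m "\<lambda>i j. M (rs i) (cs j)"]
      by (simp add: minors_ideal_def ideal.span_zero)
  qed
qed

text \<open>
  One inclusion of the Cauchy--Binet formula: the minors of a product \<open>C M D\<close> lie in the ideal of
  the minors of \<open>M\<close>. It allows passing from the Jacobian matrix of given generators in the
  given variables to the gradients of chosen quadrics in adapted coordinates.
\<close>

lemma det_of_combined_matrix_in_minors_ideal:
  assumes "finite A" "finite B"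
    and f: "\<And>i j. i < m \<Longrightarrow> j < m \<Longrightarrow> f i j = (\<Sum>g\<in>A. \<Sum>v\<in>B. c i g * M g v * d v j)"
  shows "det_of m f \<in> minors_ideal m A B M"
proof (rule det_of_combined_rows_in_ideal[OF _ \<open>finite A\<close>])
  show I: "ideal.subspace (minors_ideal m A B M)"
    by (simp add: minors_ideal_def)
  show "f i j = (\<Sum>g\<in>A. c i g * (\<Sum>v\<in>B. M g v * d v j))" if "i < m" "j < m" for i j
    unfolding f[OF that] sum_distrib_left mult.assoc ..
  fix \<sigma> assume \<sigma>: "\<And>i. i < m \<Longrightarrow> \<sigma> i \<in> A"
  have "det_of m (\<lambda>j i. \<Sum>v\<in>B. M (\<sigma> i) v * d v j) \<in> minors_ideal m A B M"
  proof (rule det_of_combined_rows_in_ideal[OF I \<open>finite B\<close>])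
    show "(\<Sum>v\<in>B. M (\<sigma> i) v * d v j) = (\<Sum>v\<in>B. d v j * M (\<sigma> i) v)" for i j
      by (simp add: mult.commute)
    fix \<tau> assume \<tau>: "\<And>j. j < m \<Longrightarrow> \<tau> j \<in> B"
    show "det_of m (\<lambda>j i. M (\<sigma> i) (\<tau> j)) \<in> minors_ideal m A B M"
      using det_of_in_minors_ideal[of m \<sigma> A \<tau> B M] \<sigma> \<tau>
        det_of_transpose[of m "\<lambda>i j. M (\<sigma> i) (\<tau> j)"] by simp
  qed
  thus "det_of m (\<lambda>i j. \<Sum>v\<in>B. M (\<sigma> i) v * d v j) \<in> minors_ideal m A B M"
    using det_of_transpose[of m "\<lambda>i j. \<Sum>v\<in>B. M (\<sigma> i) v * d v j"] by simp
qed

section \<open>Products and powers of ideals\<close>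

lemma subspace_ideal_mult [simp]: "ideal.subspace (ideal_mult I J)"
  by (simp add: ideal_mult_def)

lemma subspace_ideal_power [simp]: "ideal.subspace (ideal_power I t)"
  by (cases t) (simp_all add: ideal.subspace_UNIV)

lemma subspace_mult_right:
  "ideal.subspace I \<Longrightarrow> x \<in> I \<Longrightarrow> x * y \<in> I" for x :: "'r::comm_ring_1"
  using ideal.subspace_scale[of I x y] by (simp add: mult.commute)

text \<open>
  Colon ideals reduce a claim about a product of two ideal elements to a claim about generators
  of one of them.
\<close>

lemma subspace_colon:
  "ideal.subspace I \<Longrightarrow> ideal.subspace {x. x * y \<in> I}" for y :: "'r::comm_ring_1"
  unfolding ideal.subspace_def by (auto simp: distrib_right mult.assoc)

lemma ideal_multI: "a \<in> I \<Longrightarrow> b \<in> J \<Longrightarrow> a * b \<in> ideal_mult I J"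
  unfolding ideal_mult_def by (rule ideal.span_base) auto

lemma ideal_mult_subsetI:
  assumes "ideal.subspace K" "\<And>a b. a \<in> I \<Longrightarrow> b \<in> J \<Longrightarrow> a * b \<in> K"
  shows "ideal_mult I J \<subseteq> K"
  unfolding ideal_mult_def by (rule ideal.span_minimal) (use assms in auto)

lemma ideal_mult_mono: "J \<subseteq> J' \<Longrightarrow> ideal_mult I J \<subseteq> ideal_mult I J'"
  by (rule ideal_mult_subsetI) (auto intro: ideal_multI)

lemma ideal_power_1: "ideal.subspace I \<Longrightarrow> ideal_power I 1 = I" for I :: "'r::comm_ring_1 set"
proof
  show "ideal_power I 1 \<subseteq> I" if "ideal.subspace I"
    using that by (simp, intro ideal_mult_subsetI)
      (auto intro: subspace_mult_right)
  show "I \<subseteq> ideal_power I 1"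
  proof
    fix x assume "x \<in> I"
    from ideal_multI[OF this UNIV_I, of 1] show "x \<in> ideal_power I 1" by simp
  qed
qed

lemma ideal_power_add:
  assumes "x \<in> ideal_power I a" "y \<in> ideal_power I b"
  shows "x * y \<in> ideal_power I (a + b)"
  using assms
proof (induction a arbitrary: x)
  case 0
  thus ?case by (simp add: ideal.subspace_scale)
next
  case (Suc a)
  have "ideal_mult I (ideal_power I a) \<subseteq> {x. x * y \<in> ideal_power I (Suc a + b)}"
  proof (rule ideal_mult_subsetI[OF subspace_colon])
    fix p q assume "p \<in> I" "q \<in> ideal_power I a"
    with Suc have "p * (q * y) \<in> ideal_power I (Suc a + b)"
      by (simp add: ideal_multI)
    thus "p * q \<in> {x. x * y \<in> ideal_power I (Suc a + b)}" by (simp add: mult.assoc)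
  qed simp
  thus ?case using Suc.prems by auto
qed

lemma ideal_power_add_subset:
  "ideal_power I (a + b) \<subseteq> ideal_mult (ideal_power I a) (ideal_power I b)"
proof (induction a)
  case 0
  show ?case using ideal_multI[of 1 UNIV _ "ideal_power I b"] by auto
next
  case (Suc a)
  let ?K = "ideal_mult (ideal_power I (Suc a)) (ideal_power I b)"
  have "p * q \<in> ?K" if p: "p \<in> I" and q: "q \<in> ideal_power I (a + b)" for p q
  proof -
    have "ideal_mult (ideal_power I a) (ideal_power I b) \<subseteq> {x. x * p \<in> ?K}"
    proof (rule ideal_mult_subsetI[OF subspace_colon[OF subspace_ideal_mult]])
      fix x y assume "x \<in> ideal_power I a" "y \<in> ideal_power I b"
      hence "(p * x) * y \<in> ?K" using p by (intro ideal_multI) (auto intro: ideal_multI)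
      thus "x * y \<in> {x. x * p \<in> ?K}" by (simp add: mult_ac)
    qed
    thus ?thesis using q Suc.IH by (auto simp: mult.commute)
  qed
  thus ?case by (simp add: ideal_mult_subsetI)
qed

lemma ideal_power_antimono: "ideal_power I (a + b) \<subseteq> ideal_power I a"
proof -
  have "ideal_mult (ideal_power I a) (ideal_power I b) \<subseteq> ideal_power I a"
    by (rule ideal_mult_subsetI) (auto intro: subspace_mult_right)
  thus ?thesis using ideal_power_add_subset by blast
qed

lemma ideal_mult_power_add:
  assumes "x \<in> ideal_mult K (ideal_power I a)" "y \<in> ideal_power I b"
  shows "y * x \<in> ideal_mult K (ideal_power I (a + b))"
proof -
  have "ideal_mult K (ideal_power I a) \<subseteq> {x. x * y \<in> ideal_mult K (ideal_power I (a + b))}"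
    by (rule ideal_mult_subsetI[OF subspace_colon])
      (auto simp: mult.assoc intro: ideal_multI ideal_power_add assms)
  thus ?thesis using assms by (auto simp: mult.commute)
qed

lemma prod_list_in_ideal_power:
  "set as \<subseteq> I \<Longrightarrow> prod_list as \<in> ideal_power I (length as)"
  by (induction as) (auto intro: ideal_multI)

lemma det_of_in_ideal_power:
  assumes "\<And>i j. i < m \<Longrightarrow> j < m \<Longrightarrow> f i j \<in> I"
  shows "det_of m f \<in> ideal_power I m"
  using assms
proof (induction m arbitrary: f)
  case (Suc m)
  have "f 0 k * ((-1) ^ k * det_of m (\<lambda>i j. f (Suc i) (if j < k then j else Suc j)))
      \<in> ideal_power I (Suc m)" if "k < Suc m" for k
    unfolding ideal_power.simps
    by (intro ideal_multI ideal.subspace_scale Suc.IH Suc.prems) (use that in auto)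
  thus ?case
    unfolding det_of_Suc
    by (intro ideal.subspace_sum subspace_ideal_power) (simp add: mult.left_commute mult.assoc)
qed simp

lemma ideal_power_span_subsetI:
  assumes "ideal.subspace K"
    and "\<And>as. length as = t \<Longrightarrow> set as \<subseteq> S \<Longrightarrow> prod_list as \<in> K"
  shows "ideal_power (ideal.span S) t \<subseteq> K"
  using assms
proof (induction t arbitrary: K)
  case 0
  have "1 \<in> K" using "0.prems"(2)[of "[]"] by simp
  thus ?case using "0.prems"(1) ideal.subspace_scale[of K 1] by auto
next
  case (Suc t)
  have "x * y \<in> K" if x: "x \<in> ideal.span S" and y: "y \<in> ideal_power (ideal.span S) t" for x y
  proof -
    have "ideal.span S \<subseteq> {x. x * y \<in> K}"
    proof (rule ideal.span_minimal[OF _ subspace_colon[OF Suc.prems(1)]])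
      show "S \<subseteq> {x. x * y \<in> K}"
      proof
        fix s assume s: "s \<in> S"
        have "ideal_power (ideal.span S) t \<subseteq> {y. y * s \<in> K}"
          by (rule Suc.IH[OF subspace_colon[OF Suc.prems(1)]])
            (use Suc.prems(2)[of "s # _"] s in \<open>auto simp: mult.commute\<close>)
        thus "s \<in> {x. x * y \<in> K}" using y by (auto simp: mult.commute)
      qed
    qed
    thus ?thesis using x by auto
  qed
  thus ?case by (simp add: ideal_mult_subsetI Suc.prems(1))
qed

text \<open>
  Write \<open>I = J + M\<^sup>n\<close>. Expanding, \<open>I\<^sup>t \<subseteq> J I\<^sup>t\<^sup>-\<^sup>1 + M\<^sup>n\<^sup>t\<close>, so by the modular law an
  element of \<open>J \<inter> I\<^sup>t\<close> is the sum of one of \<open>J I\<^sup>t\<^sup>-\<^sup>1\<close> and one of \<open>J \<inter> M\<^sup>n\<^sup>t\<close>. The latter lies in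
  \<open>J M\<^sup>n\<^sup>t\<^sup>-\<^sup>2\<close>, and \<open>n t - 2 \<ge> n (t - 1)\<close>. The hypothesis \<open>order\<close> is what a homogeneous ideal generated
  by quadrics satisfies with respect to the irrelevant ideal \<open>M\<close>.
\<close>

lemma aluffi_torsion_free_add_power:
  fixes J M :: "'r::comm_ring_1 set"
  assumes J: "ideal.subspace J" and n: "2 \<le> n"
    and order: "\<And>d. 2 \<le> d \<Longrightarrow> J \<inter> ideal_power M d \<subseteq> ideal_mult J (ideal_power M (d - 2))"
  shows "aluffi_torsion_free J (ideal.span (J \<union> ideal_power M n))"
proof -
  define D where "D = ideal_power M n"
  define I where "I = ideal.span (J \<union> D)"
  have I: "ideal.subspace I" by (simp add: I_def)
  have JI: "J \<subseteq> I" and DI: "D \<subseteq> I" using ideal.span_superset[of "J \<union> D"] by (auto simp: I_def)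
  have I_elt: "\<exists>a\<in>J. \<exists>b\<in>D. x = a + b" if "x \<in> I" for x
  proof -
    have "ideal.span J = J" "ideal.span D = D"
      using J by (auto simp: D_def ideal.span_eq_iff)
    hence "I = {a + b | a b. a \<in> J \<and> b \<in> D}"
      unfolding I_def ideal.span_Un by (simp only:)
    thus ?thesis using that by auto
  qed
  have D_power: "ideal_power M (n * t) \<subseteq> ideal_power I t" for t
  proof (induction t)
    case (Suc t)
    have "ideal_power M (n * Suc t) \<subseteq> ideal_mult D (ideal_power M (n * t))"
      using ideal_power_add_subset[of M n "n * t"] by (simp add: D_def)
    also have "\<dots> \<subseteq> ideal_power I (Suc t)"
      using DI Suc.IH by (intro ideal_mult_subsetI) (auto intro: ideal_multI)
    finally show ?case .
  qed simp
  have split: "\<exists>a\<in>ideal_mult J (ideal_power I t). \<exists>b\<in>ideal_power M (n * Suc t). x = a + b"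
    if "x \<in> ideal_power I (Suc t)" for t x
    using that
  proof (induction t arbitrary: x)
    case 0
    then obtain a b where "a \<in> J" "b \<in> D" "x = a + b"
      using I_elt[of x] ideal_power_1[OF I] by auto
    thus ?case using ideal_multI[of a J 1 UNIV] by (auto simp: D_def)
  next
    case (Suc t)
    let ?S = "{a + b | a b. a \<in> ideal_mult J (ideal_power I (Suc t)) \<and> b \<in> ideal_power M (n * Suc (Suc t))}"
    have "ideal_mult I (ideal_power I (Suc t)) \<subseteq> ?S"
    proof (rule ideal_mult_subsetI)
      have "ideal.subspace (ideal.span (ideal_mult J (ideal_power I (Suc t)) \<union>
          ideal_power M (n * Suc (Suc t))))" by simp
      moreover have "ideal.span (ideal_mult J (ideal_power I (Suc t))) = ideal_mult J (ideal_power I (Suc t))"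
        "ideal.span (ideal_power M (n * Suc (Suc t))) = ideal_power M (n * Suc (Suc t))"
        by (simp_all only: ideal.span_eq_iff subspace_ideal_mult subspace_ideal_power)
      ultimately show "ideal.subspace ?S" unfolding ideal.span_Un by (simp only:)
      fix x y assume x: "x \<in> I" and y: "y \<in> ideal_power I (Suc t)"
      from I_elt[OF x] obtain a b where ab: "a \<in> J" "b \<in> D" "x = a + b" by auto
      from Suc.IH[OF y] obtain a' b' where a'b': "a' \<in> ideal_mult J (ideal_power I t)"
        "b' \<in> ideal_power M (n * Suc t)" "y = a' + b'" by auto
      have "b \<in> ideal_power I 1" using ab DI ideal_power_1[OF I] by auto
      from ideal_mult_power_add[OF a'b'(1) this]
      have "b * a' \<in> ideal_mult J (ideal_power I (Suc t))" by simp
      moreover have "a * y \<in> ideal_mult J (ideal_power I (Suc t))"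
        using ab y by (intro ideal_multI)
      ultimately have "a * y + b * a' \<in> ideal_mult J (ideal_power I (Suc t))"
        by (intro ideal.subspace_add) auto
      moreover have "b * b' \<in> ideal_power M (n * Suc (Suc t))"
        using ideal_power_add[of b M n b' "n * Suc t"] ab a'b' by (simp add: D_def)
      moreover have "x * y = (a * y + b * a') + b * b'"
        by (simp add: ab a'b' algebra_simps)
      ultimately show "x * y \<in> ?S" by blast
    qed
    hence "x \<in> ?S"
      using Suc.prems unfolding ideal_power.simps(2)[of I "Suc t"] by (rule subsetD)
    thus ?case by blast
  qed
  have "J \<inter> ideal_power I t = ideal_mult J (ideal_power I (t - 1))" if t: "2 \<le> t" for t
  proof
    obtain s where s: "t = Suc s" "1 \<le> s" using t by (cases t) auto
    show "ideal_mult J (ideal_power I (t - 1)) \<subseteq> J \<inter> ideal_power I t"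
    proof
      have "ideal_mult J (ideal_power I s) \<subseteq> J"
        using J by (intro ideal_mult_subsetI) (auto intro: subspace_mult_right)
      moreover have "ideal_mult J (ideal_power I s) \<subseteq> ideal_power I (Suc s)"
        using JI by (intro ideal_mult_subsetI) (auto intro: ideal_multI)
      ultimately show "x \<in> J \<inter> ideal_power I t" if "x \<in> ideal_mult J (ideal_power I (t - 1))" for x
        using that s by auto
    qed
    show "J \<inter> ideal_power I t \<subseteq> ideal_mult J (ideal_power I (t - 1))"
    proof
      fix x assume x: "x \<in> J \<inter> ideal_power I t"
      then obtain a b where ab: "a \<in> ideal_mult J (ideal_power I s)"
        "b \<in> ideal_power M (n * t)" "x = a + b" using split[of x s] s by auto
      have "ideal_mult J (ideal_power I s) \<subseteq> J"
        using J by (intro ideal_mult_subsetI) (auto intro: subspace_mult_right)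
      hence "a \<in> J" using ab(1) by auto
      hence "b \<in> J" using x ab ideal.subspace_diff[OF J, of x a] by simp
      have "2 * 1 \<le> n * t" using n t by (intro mult_le_mono) auto
      hence "b \<in> ideal_mult J (ideal_power M (n * t - 2))"
        using order[of "n * t"] ab \<open>b \<in> J\<close> by auto
      moreover have "n * t - 2 = n * s + (n - 2)" using s n by (simp add: algebra_simps)
      ultimately have "b \<in> ideal_mult J (ideal_power I s)"
        using ideal_mult_mono[of "ideal_power M (n * s + (n - 2))" "ideal_power I s" J]
          ideal_power_antimono[of M "n * s" "n - 2"] D_power[of s] by auto
      hence "a + b \<in> ideal_mult J (ideal_power I s)"
        by (intro ideal.subspace_add subspace_ideal_mult ab(1))
      thus "x \<in> ideal_mult J (ideal_power I (t - 1))" using ab s by simp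
    qed
  qed
  thus ?thesis
    unfolding aluffi_torsion_free_def using J I JI by (auto simp: I_def D_def)
qed

section \<open>Minors of differences of edge vectors\<close>

text \<open>
  The gradient \<open>x\<^sub>j e\<^sub>i + x\<^sub>i e\<^sub>j\<close> of the monomial \<open>x\<^sub>i x\<^sub>j\<close>, seen as the weighted incidence vector of
  the edge \<open>ij\<close> of the complete graph on the variables.
\<close>

definition edge_row :: "('v \<Rightarrow> 'r::comm_ring_1) \<Rightarrow> 'v \<Rightarrow> 'v \<Rightarrow> 'v \<Rightarrow> 'r" where
  "edge_row x i j s = (if s = i then x j else 0) + (if s = j then x i else 0)"

definition difference_row :: "('v \<Rightarrow> 'r::comm_ring_1) \<Rightarrow> ('v \<times> 'v) \<times> ('v \<times> 'v) \<Rightarrow> 'v \<Rightarrow> 'r" where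
  "difference_row x q s = (case q of ((i, j), (k, l)) \<Rightarrow> edge_row x i j s - edge_row x k l s)"

definition edge_pairs :: "'v set \<Rightarrow> (('v \<times> 'v) \<times> ('v \<times> 'v)) set" where
  "edge_pairs X = {((i, j), (k, l)) | i j k l. {i, j, k, l} \<subseteq> X \<and> i \<noteq> j \<and> k \<noteq> l}"

text \<open>
  The rows are the edges \<open>ab\<close>, \<open>bc\<close>, \<open>ac\<close> of a triangle, each minus the edge \<open>ad\<close> that hangs off the
  triangle; the three minors arise from deleting the columns \<open>a\<close>, \<open>b\<close> and \<open>d\<close> respectively.
\<close>

lemma four_variable_minors:
  fixes x :: "'v \<Rightarrow> 'r::comm_ring_1"
  assumes I: "ideal.subspace I"
    and dets: "\<And>qs cs. range qs \<subseteq> edge_pairs X \<Longrightarrow> range cs \<subseteq> X \<Longrightarrow>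
        det_of 3 (\<lambda>i j. difference_row x (qs i) (cs j)) \<in> I"
    and dist: "distinct [a, b, c, d]" and X: "{a, b, c, d} \<subseteq> X"
  shows "x a * x a * (x b + x c - x a) \<in> I"
    and "x a * x b * (x a + x c - x b) \<in> I"
    and "x a * x d * (x b + x c - x a) - 2 * (x a * x b * x c) \<in> I"
proof -
  define qs where "qs i = (if i = 0 then ((a, b), (a, d)) else if i = 1 then ((b, c), (a, d))
     else ((a, c), (a, d)))" for i :: nat
  have qs: "range qs \<subseteq> edge_pairs X"
    using dist X by (auto simp: qs_def edge_pairs_def)
  have det: "det_of 3 (\<lambda>i j. difference_row x (qs i) (if j = 0 then u else if j = 1 then v else w)) \<in> I"
    if "{u, v, w} \<subseteq> X" for u v w
    using dets[OF qs, of "\<lambda>j. if j = 0 then u else if j = 1 then v else w"] that by auto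
  have ne: "a \<noteq> b" "a \<noteq> c" "a \<noteq> d" "b \<noteq> c" "b \<noteq> d" "c \<noteq> d"
    "b \<noteq> a" "c \<noteq> a" "d \<noteq> a" "c \<noteq> b" "d \<noteq> b" "d \<noteq> c"
    using dist by auto
  have entries:
    "difference_row x (qs 0) a = x b - x d" "difference_row x (qs 0) b = x a"
    "difference_row x (qs 0) c = 0" "difference_row x (qs 0) d = - x a"
    "difference_row x (qs 1) a = - x d" "difference_row x (qs 1) b = x c"
    "difference_row x (qs 1) c = x b" "difference_row x (qs 1) d = - x a"
    "difference_row x (qs 2) a = x c - x d" "difference_row x (qs 2) b = 0"
    "difference_row x (qs 2) c = x a" "difference_row x (qs 2) d = - x a"
    by (simp_all add: qs_def difference_row_def edge_row_def ne)
  have n12: "(1::nat) \<noteq> 0" "(2::nat) \<noteq> 0" "(2::nat) \<noteq> 1" by simp_all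
  note eval = det_of_3 n12[THEN if_not_P] entries if_P[OF refl]
  have "- (x a * x a * (x b + x c - x a)) = 
      det_of 3 (\<lambda>i j. difference_row x (qs i) (if j = 0 then b else if j = 1 then c else d))"
    unfolding eval by (simp add: algebra_simps)
  also have "\<dots> \<in> I" by (rule det) (use X in auto)
  finally show "x a * x a * (x b + x c - x a) \<in> I"
    using ideal.subspace_neg[OF I] by fastforce
  have "x a * x b * (x a + x c - x b) = 
      det_of 3 (\<lambda>i j. difference_row x (qs i) (if j = 0 then a else if j = 1 then c else d))"
    unfolding eval by (simp add: algebra_simps)
  also have "\<dots> \<in> I" by (rule det) (use X in auto)
  finally show "x a * x b * (x a + x c - x b) \<in> I" .
  have "- (x a * x d * (x b + x c - x a) - 2 * (x a * x b * x c)) = 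
      det_of 3 (\<lambda>i j. difference_row x (qs i) (if j = 0 then a else if j = 1 then b else c))"
    unfolding eval by (simp add: algebra_simps)
  also have "\<dots> \<in> I" by (rule det) (use X in auto)
  finally show "x a * x d * (x b + x c - x a) - 2 * (x a * x b * x c) \<in> I"
    using ideal.subspace_neg[OF I] by fastforce
qed

text \<open>
  Modulo the ideal, the relations between the cubics identify all monomials \<open>x\<^sub>a x\<^sub>b x\<^sub>c\<close> and
  \<open>x\<^sub>a x\<^sub>b\<^sup>2\<close> with each other; the relation \<open>x\<^sub>a\<^sup>2 x\<^sub>b + x\<^sub>a x\<^sub>b x\<^sub>c - x\<^sub>a x\<^sub>b\<^sup>2\<close> then makes their common class zero,
  and the cubes follow. All combinations have integer coefficients and no division takes place,
  so that the argument is valid in every characteristic.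
\<close>

lemma cubic_monomials_from_four_variable_minors:
  fixes x :: "'v \<Rightarrow> 'r::comm_ring_1"
  assumes I: "ideal.subspace I"
    and dets: "\<And>qs cs. range qs \<subseteq> edge_pairs X \<Longrightarrow> range cs \<subseteq> X \<Longrightarrow>
        det_of 3 (\<lambda>i j. difference_row x (qs i) (cs j)) \<in> I"
    and card: "card X = 4" and abc: "{a, b, c} \<subseteq> X"
  shows "x a * x b * x c \<in> I"
proof -
  note minors = four_variable_minors[where X = X and I = I and x = x, OF I dets]
  note closed = ideal.subspace_add[OF I] ideal.subspace_diff[OF I]
  \<comment> \<open>This cancels the term \<open>2 x\<^sub>a x\<^sub>b x\<^sub>c\<close> of the third minor.\<close>
  have double: "2 * (x a * x b * x c) \<in> I"
    if "distinct [a, b, c, d]" "{a, b, c, d} \<subseteq> X" for a b c d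
  proof -
    have "x a * x b * (x a + x c - x b) + x b * x a * (x b + x c - x a) \<in> I"
      by (intro closed minors(2)[of a b c d] minors(2)[of b a c d]) (use that in auto)
    thus ?thesis by (simp add: algebra_simps)
  qed
  have swap: "x a * x d * (x b - x d) \<in> I"
    if "distinct [a, b, c, d]" "{a, b, c, d} \<subseteq> X" for a b c d
  proof -
    have "x a * x d * (x b + x c - x a) - 2 * (x a * x b * x c) + 2 * (x a * x b * x c)
         - x d * x a * (x d + x c - x a) \<in> I"
      by (intro closed minors(3)[of a b c d] minors(2)[of d a c b] double[of a b c d]) (use that in auto)
    thus ?thesis by (simp add: algebra_simps)
  qed
  have squarefree: "x a * x b * x c \<in> I"
    if "distinct [a, b, c, d]" "{a, b, c, d} \<subseteq> X" for a b c d
  proof -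
    have "x a * x b * (x a + x c - x b) - x a * x b * (x c - x b) + x b * x a * (x c - x a) \<in> I"
      by (intro closed minors(2)[of a b c d] swap[of a c d b] swap[of b c d a]) (use that in auto)
    thus ?thesis by (simp add: algebra_simps)
  qed
  have square: "x a * x b * x b \<in> I"
    if "distinct [a, b, c, d]" "{a, b, c, d} \<subseteq> X" for a b c d
  proof -
    have "x a * x b * x c - x a * x b * (x c - x b) \<in> I"
      by (intro closed squarefree[of a b c d] swap[of a c d b]) (use that in auto)
    thus ?thesis by (simp add: algebra_simps)
  qed
  have cube: "x a * x a * x a \<in> I"
    if "distinct [a, b, c, d]" "{a, b, c, d} \<subseteq> X" for a b c d
  proof -
    have "x b * x a * x a + x c * x a * x a - x a * x a * (x b + x c - x a) \<in> I"
      by (intro closed minors(1)[of a b c d] square[of b a c d] square[of c a b d]) (use that in auto)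
    thus ?thesis by (simp add: algebra_simps)
  qed
  have others: "\<exists>v\<in>X. v \<notin> set vs" if "length vs \<le> 3" for vs
  proof (rule ccontr)
    assume "\<not> (\<exists>v\<in>X. v \<notin> set vs)"
    hence "card X \<le> card (set vs)" by (intro card_mono) auto
    also have "\<dots> \<le> length vs" by (rule card_length)
    finally show False using that card by simp
  qed
  consider "distinct [a, b, c]" | "a = b" "b = c" | "a = b" "b \<noteq> c" | "b = c" "a \<noteq> b" | "a = c" "b \<noteq> c"
    by force
  thus ?thesis
  proof cases
    case 1
    obtain d where "d \<in> X" "d \<notin> set [a, b, c]" using others[of "[a, b, c]"] by auto
    thus ?thesis using 1 abc by (intro squarefree[of a b c d]) auto
  next
    case 2
    obtain d where d: "d \<in> X" "d \<notin> set [a]" using others[of "[a]"] by auto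
    obtain e where e: "e \<in> X" "e \<notin> set [a, d]" using others[of "[a, d]"] by auto
    obtain f where f: "f \<in> X" "f \<notin> set [a, d, e]" using others[of "[a, d, e]"] by auto
    show ?thesis using 2 abc d e f cube[of a d e f] by auto
  next
    case 3
    obtain d where d: "d \<in> X" "d \<notin> set [a, c]" using others[of "[a, c]"] by auto
    obtain e where e: "e \<in> X" "e \<notin> set [a, c, d]" using others[of "[a, c, d]"] by auto
    show ?thesis using 3 abc d e square[of c a d e] by (auto simp: mult_ac)
  next
    case 4
    obtain d where d: "d \<in> X" "d \<notin> set [a, c]" using others[of "[a, c]"] by auto
    obtain e where e: "e \<in> X" "e \<notin> set [a, c, d]" using others[of "[a, c, d]"] by auto
    show ?thesis using 4 abc d e square[of a c d e] by (auto simp: mult_ac)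
  next
    case 5
    obtain d where d: "d \<in> X" "d \<notin> set [a, b]" using others[of "[a, b]"] by auto
    obtain e where e: "e \<in> X" "e \<notin> set [a, b, d]" using others[of "[a, b, d]"] by auto
    show ?thesis using 5 abc d e square[of b a d e] by (auto simp: mult_ac)
  qed
qed

text \<open>
  Induction on the number of variables. A monomial of degree \<open>m + 1\<close> in \<open>m + 2\<close> variables omits some
  variable \<open>s\<close>. If \<open>x\<^sub>a\<close> divides it, attach \<open>s\<close> to \<open>a\<close> as a pendant vertex: the column of \<open>s\<close> then
  has \<open>x\<^sub>a\<close> as its only nonzero entry, so the new minors are \<open>x\<^sub>a\<close> times the old ones, which live on the
  variables other than \<open>s\<close>.
\<close>

lemma monomials_from_difference_row_minors:
  fixes x :: "'v \<Rightarrow> 'r::comm_ring_1"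
  assumes "ideal.subspace I"
    and "\<And>qs cs. range qs \<subseteq> edge_pairs X \<Longrightarrow> range cs \<subseteq> X \<Longrightarrow>
        det_of m (\<lambda>i j. difference_row x (qs i) (cs j)) \<in> I"
    and "card X = Suc m" and "3 \<le> m" and "length vs = m" and "set vs \<subseteq> X"
  shows "prod_list (map x vs) \<in> I"
  using \<open>3 \<le> m\<close> assms(1-3,5-)
proof (induction m arbitrary: I X vs rule: dec_induct)
  case base
  then obtain a b c where "vs = [a, b, c]"
    by (auto simp: numeral_3_eq_3 length_Suc_conv)
  thus ?case
    using cubic_monomials_from_four_variable_minors[of I X x a b c] base by (simp add: mult.assoc)
next
  case (step m)
  then obtain a us where vs: "vs = a # us" and us: "length us = m"
    by (auto simp: length_Suc_conv)
  have "finite X" using step.prems by (intro card_ge_0_finite) simp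
  obtain s where s: "s \<in> X" "s \<notin> set vs"
  proof -
    have "card (set vs) < card X" using card_length[of vs] step.prems by linarith
    hence "\<not> X \<subseteq> set vs" using card_mono[of "set vs" X] by auto
    thus ?thesis using that by blast
  qed
  define Y where "Y = X - {s}"
  have Y: "card Y = Suc m" using step.prems s by (simp add: Y_def)
  have vsY: "set vs \<subseteq> Y" using step.prems s by (auto simp: Y_def)
  \<comment> \<open>Any edge avoiding \<open>s\<close> serves as the one subtracted from the new edge \<open>as\<close>.\<close>
  obtain k l where kl: "k \<in> Y" "l \<in> Y" "k \<noteq> l"
  proof -
    have "2 \<le> card Y" using Y step.hyps by simp
    then obtain T where "T \<subseteq> Y" "card T = 2" using obtain_subset_with_card_n by metis
    thus ?thesis using that by (auto simp: card_2_iff)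
  qed
  define K where "K = {y. x a * y \<in> I}"
  have "prod_list (map x us) \<in> K"
  proof (rule step.IH[of K Y us])
    show "ideal.subspace K"
      using step.prems(1) unfolding K_def ideal.subspace_def
      by (auto simp: distrib_left mult.left_commute)
    fix qs :: "nat \<Rightarrow> ('v \<times> 'v) \<times> ('v \<times> 'v)" and cs :: "nat \<Rightarrow> 'v"
    assume qs: "range qs \<subseteq> edge_pairs Y" and cs: "range cs \<subseteq> Y"
    define qs' where "qs' = case_nat ((a, s), (k, l)) qs"
    define cs' where "cs' = case_nat s cs"
    have "det_of (Suc m) (\<lambda>i j. difference_row x (qs' i) (cs' j)) \<in> I"
    proof (rule step.prems(2))
      show "range qs' \<subseteq> edge_pairs X"
      proof (rule image_subsetI)
        fix i
        show "qs' i \<in> edge_pairs X"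
        proof (cases i)
          case 0
          thus ?thesis using kl s vsY unfolding qs'_def vs edge_pairs_def Y_def by auto
        next
          case (Suc j)
          have "qs j \<in> edge_pairs Y" using qs by auto
          thus ?thesis unfolding Suc qs'_def edge_pairs_def Y_def by auto
        qed
      qed
      show "range cs' \<subseteq> X"
        using cs s by (auto simp: cs'_def Y_def image_subset_iff split: nat.splits)
    qed
    also have "det_of (Suc m) (\<lambda>i j. difference_row x (qs' i) (cs' j)) =
        difference_row x (qs' 0) (cs' 0) *
        det_of m (\<lambda>i j. difference_row x (qs' (Suc i)) (cs' (Suc j)))"
    proof (rule det_of_Suc_first_column)
      fix i
      have "qs i \<in> edge_pairs Y" using qs by auto
      thus "difference_row x (qs' (Suc i)) (cs' 0) = 0"
        by (auto simp: qs'_def cs'_def edge_pairs_def difference_row_def edge_row_def Y_def)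
    qed
    also have "difference_row x (qs' 0) (cs' 0) = x a"
      using kl s vs by (auto simp: qs'_def cs'_def difference_row_def edge_row_def Y_def)
    finally show "det_of m (\<lambda>i j. difference_row x (qs i) (cs j)) \<in> K"
      by (simp add: K_def qs'_def cs'_def)
  qed (use Y us vsY vs in auto)
  thus ?case by (simp add: K_def vs)
qed

section \<open>Polynomials and their homogeneous components\<close>

abbreviation monomial :: "('v \<Rightarrow>\<^sub>0 nat) \<Rightarrow> 'a::comm_ring_1 \<Rightarrow> ('v, 'a) mpoly" where
  "monomial \<equiv> Poly_Mapping.single"

abbreviation mcoeff :: "('v, 'a::comm_ring_1) mpoly \<Rightarrow> ('v \<Rightarrow>\<^sub>0 nat) \<Rightarrow> 'a" where
  "mcoeff \<equiv> Poly_Mapping.lookup"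

lemma monomial_sum: "monomial m (sum f A) = (\<Sum>x\<in>A. monomial m (f x))"
  by (induction A rule: infinite_finite_induct) (simp_all add: single_add)

lemma mpoly_as_sum: "f = (\<Sum>m\<in>Poly_Mapping.keys f. monomial m (mcoeff f m))"
proof (rule poly_mapping_eqI)
  fix k
  show "mcoeff f k = mcoeff (\<Sum>m\<in>Poly_Mapping.keys f. monomial m (mcoeff f m)) k"
    by (cases "k \<in> Poly_Mapping.keys f")
      (auto simp: lookup_sum lookup_single when_def in_keys_iff sum.delta)
qed

text \<open>
  The monomial case keeps the exponent vector among those of \<open>f\<close>, so that degree bounds on \<open>f\<close>
  remain available.
\<close>

lemma mpoly_induct [case_names zero monomial add]:
  fixes f :: "('v, 'a::comm_ring_1) mpoly"
  assumes "P 0" "\<And>m a. a \<noteq> 0 \<Longrightarrow> m \<in> Poly_Mapping.keys f \<Longrightarrow> P (monomial m a)" "\<And>f g. P f \<Longrightarrow> P g \<Longrightarrow> P (f + g)"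
  shows "P f"
proof -
  have "P (\<Sum>m\<in>A. monomial m (mcoeff f m))" if "A \<subseteq> Poly_Mapping.keys f" for A
    using finite_subset[OF that finite_keys] that
    by (induction A rule: finite_induct) (auto intro!: assms simp: in_keys_iff)
  thus ?thesis using mpoly_as_sum[of f] by fastforce
qed

lemma sum_keys_single:
  "\<phi> m 0 = 0 \<Longrightarrow> (\<Sum>k\<in>Poly_Mapping.keys (monomial m a). \<phi> k (mcoeff (monomial m a) k)) = \<phi> m a"
  by (cases "a = 0") auto

lemma mdeg_add [simp]: "mdeg (m + m') = mdeg m + mdeg m'"
  by (simp add: mdeg_def lookup_add sum.distrib)

lemma mdeg_single [simp]: "mdeg (Poly_Mapping.single i e) = e"
  by (simp add: mdeg_def lookup_single when_def)

lemma mdeg_zero [simp]: "mdeg 0 = 0"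
  by (simp add: mdeg_def)

lemma mdeg_eq_0_iff: "mdeg m = 0 \<longleftrightarrow> m = 0"
  by (auto simp: mdeg_def intro!: poly_mapping_eqI)

lemma split_off_variable:
  assumes "0 < mdeg m"
  obtains i m' where "m = Poly_Mapping.single i 1 + m'"
proof -
  obtain i where i: "Poly_Mapping.lookup m i \<noteq> 0"
    using assms mdeg_eq_0_iff[of m] by (metis poly_mapping_eqI lookup_zero less_irrefl)
  have "m = Poly_Mapping.single i 1 + (m - Poly_Mapping.single i 1)"
    using i by (intro poly_mapping_eqI) (auto simp: lookup_add lookup_minus lookup_single when_def)
  thus ?thesis using that by blast
qed

lemma monomial_add_eq_Var_mult: "monomial (Poly_Mapping.single i 1 + m) a = Var i * monomial m a"
  by (simp add: Var_def mult_single)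

lemma eval_zero [simp]: "eval_mpoly 0 v = 0"
  by (simp add: eval_mpoly_def)

lemma eval_monomial [simp]:
  "eval_mpoly (monomial m a) v = a * (\<Prod>i\<in>UNIV. vec_nth v i ^ Poly_Mapping.lookup m i)"
  unfolding eval_mpoly_def
  by (rule sum_keys_single[where \<phi> = "\<lambda>m a. a * (\<Prod>i\<in>UNIV. vec_nth v i ^ Poly_Mapping.lookup m i)"]) simp

lemma eval_add [simp]: "eval_mpoly (f + g) v = eval_mpoly f v + eval_mpoly g v"
  unfolding eval_mpoly_def by (rule setsum_keys_plus_distrib) (auto simp: algebra_simps)

lemma eval_mult [simp]: "eval_mpoly (f * g) v = eval_mpoly f v * eval_mpoly g v"
proof (induction f rule: mpoly_induct)
  case (monomial m a)
  show ?case
    by (induction g rule: mpoly_induct)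
      (simp_all add: mult_single lookup_add power_add prod.distrib algebra_simps)
qed (simp_all add: algebra_simps)

lemma eval_sum [simp]: "eval_mpoly (sum f A) v = (\<Sum>x\<in>A. eval_mpoly (f x) v)"
  by (induction A rule: infinite_finite_induct) auto

lemma eval_minus [simp]: "eval_mpoly (f - g) v = eval_mpoly f v - eval_mpoly g v"
  using eval_add[of "f - g" g v] by simp

lemma eval_Var [simp]: "eval_mpoly (Var i) v = vec_nth v i"
proof -
  have "(\<Prod>j\<in>UNIV. vec_nth v j ^ Poly_Mapping.lookup (Poly_Mapping.single i (Suc 0)) j) =
     (\<Prod>j\<in>UNIV. if j = i then vec_nth v j else 1)"
    by (rule prod.cong) (auto simp: lookup_single when_def)
  thus ?thesis by (simp add: Var_def)
qed

lemma eval_const [simp]: "eval_mpoly (monomial 0 a) v = a"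
  by simp

lemma eval_one [simp]: "eval_mpoly 1 v = 1"
  using eval_const[of 1 v] by (simp only: single_one)

lemma partial_deriv_zero [simp]: "partial_deriv i 0 = 0"
  by (simp add: partial_deriv_def)

lemma partial_deriv_monomial: 
  "partial_deriv i (monomial m a) = monomial (m - Poly_Mapping.single i 1) (of_nat (Poly_Mapping.lookup m i) * a)"
  unfolding partial_deriv_def
  by (rule sum_keys_single[where \<phi> = "\<lambda>m a. monomial (m - Poly_Mapping.single i 1) (of_nat (Poly_Mapping.lookup m i) * a)"]) simp

lemma partial_deriv_add [simp]: "partial_deriv i (f + g) = partial_deriv i f + partial_deriv i g"
  unfolding partial_deriv_def by (rule setsum_keys_plus_distrib) (auto simp: algebra_simps single_add)

lemma partial_deriv_sum: "partial_deriv i (sum f A) = (\<Sum>x\<in>A. partial_deriv i (f x))"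
  by (induction A rule: infinite_finite_induct) auto

lemma partial_deriv_minus [simp]: "partial_deriv i (f - g) = partial_deriv i f - partial_deriv i g"
  using partial_deriv_add[of i "f - g" g] by simp

text \<open>
  Half of the Leibniz rule for monomials. The truncated subtraction of exponents is harmless: where
  it truncates, both coefficients vanish.
\<close>

lemma partial_deriv_monomial_mult_monomial:
  "monomial ((m + m') - Poly_Mapping.single i 1) (of_nat (Poly_Mapping.lookup m i) * (a * b))
   = monomial (m - Poly_Mapping.single i 1) (of_nat (Poly_Mapping.lookup m i) * a) * monomial m' b"
proof (cases "Poly_Mapping.lookup m i = 0")
  case False
  hence "(m + m') - Poly_Mapping.single i 1 = (m - Poly_Mapping.single i 1) + m'"
    by (intro poly_mapping_eqI) (auto simp: lookup_add lookup_minus lookup_single when_def)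
  thus ?thesis by (simp add: mult_single mult.assoc)
qed simp

lemma partial_deriv_mult:
  "partial_deriv i (f * g) = partial_deriv i f * g + f * partial_deriv i g"
proof (induction f rule: mpoly_induct)
  case (monomial m a)
  show ?case
  proof (induction g rule: mpoly_induct)
    case (monomial m' b)
    show ?case
      using partial_deriv_monomial_mult_monomial[of m m' i a b] partial_deriv_monomial_mult_monomial[of m' m i b a]
      by (simp add: mult_single partial_deriv_monomial lookup_add distrib_left distrib_right single_add mult_ac add_ac)
  qed (simp_all add: algebra_simps)
qed (simp_all add: algebra_simps)

lemma partial_deriv_const [simp]: "partial_deriv i (monomial 0 a) = 0"
  by (simp add: partial_deriv_monomial)

lemma partial_deriv_Var: "partial_deriv i (Var j) = (if i = j then 1 else 0)"
  by (auto simp: Var_def partial_deriv_monomial lookup_single when_def simp flip: single_one)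

definition component :: "nat \<Rightarrow> ('v::finite, 'a::comm_ring_1) mpoly \<Rightarrow> ('v, 'a) mpoly" where
  "component d f = (\<Sum>m\<in>Poly_Mapping.keys f. if mdeg m = d then monomial m (mcoeff f m) else 0)"

definition homogeneous_of_degree :: "nat \<Rightarrow> ('v::finite, 'a::comm_ring_1) mpoly \<Rightarrow> bool" where
  "homogeneous_of_degree d f \<longleftrightarrow> (\<forall>m\<in>Poly_Mapping.keys f. mdeg m = d)"

lemma component_monomial: "component d (monomial m a) = (if mdeg m = d then monomial m a else 0)"
  unfolding component_def
  by (rule sum_keys_single[where \<phi> = "\<lambda>m a. if mdeg m = d then monomial m a else 0"]) simp

lemma component_zero [simp]: "component d 0 = 0"
  by (simp add: component_def)

lemma component_add [simp]: "component d (f + g) = component d f + component d g"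
  unfolding component_def by (rule setsum_keys_plus_distrib) (auto simp: single_add)

lemma component_sum: "component d (sum f A) = (\<Sum>x\<in>A. component d (f x))"
  by (induction A rule: infinite_finite_induct) auto

lemma component_monomial_mult:
  "component d (monomial m a * f) = (if mdeg m \<le> d then monomial m a * component (d - mdeg m) f else 0)"
  by (induction f rule: mpoly_induct) (auto simp: mult_single component_monomial algebra_simps)

lemma coeff_component: "mcoeff (component d f) m = (if mdeg m = d then mcoeff f m else 0)"
  by (induction f rule: mpoly_induct) (auto simp: component_monomial lookup_single when_def lookup_add)

lemma homogeneous_component [simp]: "homogeneous_of_degree d (component d f)"
  by (auto simp: homogeneous_of_degree_def in_keys_iff coeff_component split: if_splits)

lemma component_homogeneous:
  "homogeneous_of_degree e f \<Longrightarrow> component d f = (if d = e then f else 0)"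
  by (intro poly_mapping_eqI) (auto simp: coeff_component homogeneous_of_degree_def in_keys_iff)

lemma mpoly_as_sum_of_components: "\<exists>N. f = (\<Sum>d<N. component d f)"
proof -
  define N where "N = Suc (Max (insert 0 (mdeg ` Poly_Mapping.keys f)))"
  have "f = (\<Sum>d<N. component d f)"
  proof (rule poly_mapping_eqI)
    fix m
    have "mdeg m < N" if "mcoeff f m \<noteq> 0"
      using that unfolding N_def by (auto simp: in_keys_iff less_Suc_eq_le intro!: Max_ge)
    thus "mcoeff f m = mcoeff (\<Sum>d<N. component d f) m"
      by (auto simp: lookup_sum coeff_component)
  qed
  thus ?thesis by blast
qed

lemma homogeneous_iff: "homogeneous f \<longleftrightarrow> (\<exists>d. homogeneous_of_degree d f)"
  by (simp add: homogeneous_def homogeneous_of_degree_def)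

lemma homogeneous_of_degree_mult:
  "homogeneous_of_degree d f \<Longrightarrow> homogeneous_of_degree e g \<Longrightarrow> homogeneous_of_degree (d + e) (f * g)"
  unfolding homogeneous_of_degree_def using keys_mult[of f g] by fastforce

lemma homogeneous_of_degree_sum:
  "(\<And>x. x \<in> A \<Longrightarrow> homogeneous_of_degree d (f x)) \<Longrightarrow> homogeneous_of_degree d (sum f A)"
  unfolding homogeneous_of_degree_def using Poly_Mapping.keys_sum[of f A] by blast

lemma homogeneous_of_degree_diff:
  "homogeneous_of_degree d f \<Longrightarrow> homogeneous_of_degree d g \<Longrightarrow> homogeneous_of_degree d (f - g)"
  unfolding homogeneous_of_degree_def by (auto simp: in_keys_iff lookup_minus)

lemma irrelevant_ideal_power:
  "ideal_power irrelevant_ideal d =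
     {f :: ('v::finite, 'a::comm_ring_1) mpoly. \<forall>m\<in>Poly_Mapping.keys f. d \<le> mdeg m}"
proof -
  define Z where "Z d = {f :: ('v, 'a) mpoly. \<forall>m\<in>Poly_Mapping.keys f. d \<le> mdeg m}" for d
  have Z_mult: "f * g \<in> Z (d + e)" if "f \<in> Z d" "g \<in> Z e" for f g d e
    using that keys_mult[of f g] unfolding Z_def by (fastforce intro: add_mono)
  have Z_sub: "ideal.subspace (Z d)" for d
    unfolding ideal.subspace_def
  proof (intro conjI ballI allI)
    show "f + g \<in> Z d" if "f \<in> Z d" "g \<in> Z d" for f g
      using that Poly_Mapping.keys_add[of f g] by (auto simp: Z_def)
    show "c * f \<in> Z d" if "f \<in> Z d" for c f
      using Z_mult[of c 0 f d] that by (simp add: Z_def)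
  qed (simp add: Z_def)
  have "ideal_power irrelevant_ideal d \<subseteq> Z d"
    unfolding irrelevant_ideal_def
  proof (rule ideal_power_span_subsetI[OF Z_sub])
    have "prod_list fs \<in> Z (length fs)" if "set fs \<subseteq> range Var" for fs :: "('v, 'a) mpoly list"
      using that
    proof (induction fs)
      case (Cons f fs)
      hence "f \<in> Z 1" by (auto simp: Z_def Var_def)
      thus ?case using Cons Z_mult[of f 1] by simp
    qed (simp add: Z_def)
    thus "prod_list fs \<in> Z d" if "length fs = d" "set fs \<subseteq> range Var" for fs :: "('v, 'a) mpoly list"
      using that by blast
  qed
  moreover have monomial: "monomial m a \<in> ideal_power irrelevant_ideal d" if "d \<le> mdeg m" for m :: "'v \<Rightarrow>\<^sub>0 nat" and a :: 'a and d
    using that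
  proof (induction d arbitrary: m)
    case (Suc d)
    then obtain i m' where m: "m = Poly_Mapping.single i 1 + m'"
      by (metis split_off_variable less_le_trans zero_less_Suc)
    have "Var i * monomial m' a \<in> ideal_power irrelevant_ideal (Suc d)"
      unfolding ideal_power.simps
      by (rule ideal_multI)
        (use Suc m in \<open>auto simp: irrelevant_ideal_def intro: ideal.span_base\<close>)
    thus ?case by (simp only: m monomial_add_eq_Var_mult)
  qed simp
  have "Z d \<subseteq> ideal_power irrelevant_ideal d"
  proof
    fix f assume "f \<in> Z d"
    hence "(\<Sum>m\<in>Poly_Mapping.keys f. monomial m (mcoeff f m)) \<in> ideal_power irrelevant_ideal d"
      by (intro ideal.subspace_sum subspace_ideal_power monomial) (simp add: Z_def)
    thus "f \<in> ideal_power irrelevant_ideal d" using mpoly_as_sum[of f] by simp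
  qed
  ultimately show ?thesis by (auto simp: Z_def)
qed

lemma irrelevant_ideal_iff:
  "(f :: ('v::finite, 'a::comm_ring_1) mpoly) \<in> irrelevant_ideal \<longleftrightarrow> (\<forall>m\<in>Poly_Mapping.keys f. 1 \<le> mdeg m)"
  using irrelevant_ideal_power[of 1, where ?'v = 'v and ?'a = 'a]
    ideal_power_1[of "irrelevant_ideal :: ('v, 'a) mpoly set"]
  by (simp add: irrelevant_ideal_def set_eq_iff)

lemma partial_deriv_in_irrelevant_ideal:
  assumes "\<And>m. m \<in> Poly_Mapping.keys f \<Longrightarrow> 2 \<le> mdeg m"
  shows "partial_deriv i f \<in> irrelevant_ideal"
proof (induction f rule: mpoly_induct)
  case (monomial m a)
  hence "2 \<le> mdeg m" by (intro assms)
  show ?case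
  proof (cases "Poly_Mapping.lookup m i = 0")
    case False
    hence "m = Poly_Mapping.single i 1 + (m - Poly_Mapping.single i 1)"
      by (intro poly_mapping_eqI) (auto simp: lookup_add lookup_minus lookup_single when_def)
    hence "mdeg m = 1 + mdeg (m - Poly_Mapping.single i 1)"
      by (metis mdeg_add mdeg_single)
    thus ?thesis using \<open>2 \<le> mdeg m\<close>
      by (auto simp: irrelevant_ideal_iff partial_deriv_monomial split: if_splits)
  qed (simp add: partial_deriv_monomial irrelevant_ideal_iff)
qed (auto simp: irrelevant_ideal_def ideal.span_zero ideal.span_add)

section \<open>Points in general linear position\<close>

text \<open>
  Up to a projective transformation, \<open>n + 2\<close> points in general linear position are the coordinate
  points and the unit point. Instead of transforming the polynomial ring, the locale keeps the given
  variables and carries a basis \<open>b\<close> with its dual basis \<open>l\<close>; the linear forms \<open>L i\<close> below are the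
  adapted coordinates. With three coordinates the pencil of conics through the four points has
  singular members, so the gradients of the quadrics drop rank at the singular points and their
  minors generate no power of the irrelevant ideal; this is why four coordinates are assumed.
\<close>

locale projective_frame =
  fixes \<Gamma> :: "('a::field ^ 'v::finite) set set" and b l :: "'v \<Rightarrow> 'a ^ 'v"
  assumes points: "\<Gamma> = insert (vec.span {\<Sum>i\<in>UNIV. b i}) (range (\<lambda>i. vec.span {b i}))"
    and dual: "\<And>i j. (\<Sum>k\<in>UNIV. l i $ k * b j $ k) = (if i = j then 1 else 0)"
    and resolution: "\<And>k k'. (\<Sum>i\<in>UNIV. b i $ k * l i $ k') = (if k = k' then 1 else 0)"
    and four_variables: "4 \<le> CARD('v)"

lemma finite_set_in_hyperplane:
  fixes T :: "('a::field ^ 'v::finite) set"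
  assumes "finite T" "card T < CARD('v)"
  shows "\<exists>H. hyperplane H \<and> T \<subseteq> H"
proof -
  obtain C where C: "C \<subseteq> T" "vec.independent C" "T \<subseteq> vec.span C"
    using vec.maximal_independent_subset[of T] by blast
  define E where "E = vec.extend_basis C"
  have E: "C \<subseteq> E" "vec.independent E" "vec.span E = UNIV"
    using vec.extend_basis_superset[OF C(2)] vec.independent_extend_basis[OF C(2)]
      vec.span_extend_basis[OF C(2)] by (simp_all add: E_def)
  have "finite E" using E(2) by (rule vec.finiteI_independent)
  have card_E: "card E = CARD('v)"
    using vec.dim_eq_card[of E UNIV] E by (simp add: card_cart_basis)
  have "card C < card E"
    using card_mono[OF assms(1) C(1)] assms(2) card_E by simp
  hence "C \<noteq> E" by auto
  then obtain e where e: "e \<in> E" "e \<notin> C" using E(1) by blast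
  let ?H = "vec.span (E - {e})"
  have "vec.dim ?H = CARD('v) - 1"
    using vec.dim_span_eq_card_independent[OF vec.independent_mono[OF E(2), of "E - {e}"]]
      e \<open>finite E\<close> card_E by (simp del: vec.dim_span)
  hence "hyperplane ?H" by (simp add: hyperplane_def)
  moreover have "T \<subseteq> ?H"
    using C(3) vec.span_mono[of C "E - {e}"] E(1) e by blast
  ultimately show ?thesis by blast
qed

text \<open>
  Representatives \<open>w\<^sub>i\<close> of all points but one form a basis, since they lie in no hyperplane. In the
  expansion of the remaining point \<open>u\<close> no coefficient \<open>c\<^sub>i\<close> vanishes, since otherwise \<open>u\<close> and the
  points other than the \<open>i\<close>-th would lie in a hyperplane. Rescaling by the \<open>c\<^sub>i\<close> makes \<open>u\<close> the sum of
  the basis vectors.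
\<close>

lemma general_linear_position_frame:
  fixes \<Gamma> :: "('a::field ^ 'v::finite) set set"
  assumes glp: "general_linear_position \<Gamma>" and card: "card \<Gamma> = CARD('v) + 1"
    and four: "4 \<le> CARD('v)"
  shows "\<exists>b l. projective_frame \<Gamma> b l"
proof -
  have fin: "finite \<Gamma>" and pts: "\<Gamma> \<subseteq> projective_points"
    using glp by (auto simp: general_linear_position_def)
  have no_hyp: "\<not> (hyperplane H \<and> (\<forall>p\<in>\<Delta>. p \<subseteq> H))" if "\<Delta> \<subseteq> \<Gamma>" "card \<Delta> = CARD('v)" for \<Delta> H
    using glp card that unfolding general_linear_position_def by auto
  obtain q where q: "q \<in> \<Gamma>" using card by (metis card.empty add_is_0 one_neq_zero all_not_in_conv)
  have "card (\<Gamma> - {q}) = CARD('v)" using q card fin by simp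
  then obtain f :: "'v \<Rightarrow> ('a ^ 'v) set" where f: "bij_betw f UNIV (\<Gamma> - {q})"
    using finite_same_card_bij[of "UNIV :: 'v set" "\<Gamma> - {q}"] fin by auto
  have "\<exists>v. v \<noteq> 0 \<and> p = vec.span {v}" if "p \<in> \<Gamma>" for p
    using pts that by (auto simp: projective_points_def)
  then obtain r where r: "\<And>p. p \<in> \<Gamma> \<Longrightarrow> r p \<noteq> 0 \<and> p = vec.span {r p}" by metis
  define w where "w i = r (f i)" for i
  have f_mem: "f i \<in> \<Gamma>" "f i \<noteq> q" for i using f by (auto simp: bij_betw_def)
  have w: "w i \<noteq> 0" "f i = vec.span {w i}" for i using r[OF f_mem(1)] by (auto simp: w_def)
  have inj_f: "inj f" using f by (auto simp: bij_betw_def)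
  have inj_w: "inj w" using inj_f w(2) by (metis injI injD)
  have in_hyp: "f i \<subseteq> H" if "hyperplane H" "w i \<in> H" for i H
    using that w(2)[of i] vec.span_minimal[of "{w i}" H] by (auto simp: hyperplane_def)
  have span_w: "vec.span (range w) = UNIV"
  proof (rule ccontr)
    assume "vec.span (range w) \<noteq> UNIV"
    hence "vec.dim (range w) < CARD('v)"
      using vec.dim_eq_full[of "range w"] dim_subset_UNIV_cart_gen[of "range w"]
      by (simp add: vec.dimension_def card_cart_basis)
    moreover obtain C where C: "C \<subseteq> range w" "vec.independent C" "range w \<subseteq> vec.span C"
      and "card C = vec.dim (range w)"
      by (rule vec.basis_exists[of "range w"])
    ultimately have "card C < CARD('v)" by (simp only:)
    obtain H where H: "hyperplane H" "C \<subseteq> H"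
      using finite_set_in_hyperplane[OF vec.finiteI_independent[OF C(2)] \<open>card C < CARD('v)\<close>] by auto
    have "vec.span C \<subseteq> H"
      using H by (intro vec.span_minimal) (simp_all add: hyperplane_def)
    hence "range w \<subseteq> H" using C(3) by (rule order_trans[rotated])
    hence "f i \<subseteq> H" for i by (intro in_hyp[OF H(1)] subsetD[OF _ rangeI])
    hence "\<forall>p\<in>range f. p \<subseteq> H" by (simp only: ball_simps) simp
    moreover have "range f = \<Gamma> - {q}" using f by (simp add: bij_betw_def)
    ultimately have "\<forall>p\<in>\<Gamma> - {q}. p \<subseteq> H" by (simp only:)
    thus False using no_hyp[of "\<Gamma> - {q}" H] H(1) \<open>card (\<Gamma> - {q}) = CARD('v)\<close> by blast
  qed
  define u where "u = r q"
  have u: "q = vec.span {u}" using r[OF q] by (simp add: u_def)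
  have "u \<in> vec.span (range w)" by (simp add: span_w)
  then obtain c' where "u = (\<Sum>v\<in>range w. c' v *s v)"
    by (auto simp: vec.span_finite)
  also have "\<dots> = (\<Sum>i\<in>UNIV. c' (w i) *s w i)"
    by (rule sum.reindex[OF inj_w, unfolded o_def])
  finally obtain c where c: "u = (\<Sum>i\<in>UNIV. c i *s w i)" by metis
  have c_nz: "c i \<noteq> 0" for i
  proof
    assume "c i = 0"
    have "card (w ` (UNIV - {i})) < CARD('v)"
      by (rule le_less_trans[OF card_image_le]) (auto intro: psubset_card_mono)
    then obtain H where H: "hyperplane H" "w ` (UNIV - {i}) \<subseteq> H"
      using finite_set_in_hyperplane[of "w ` (UNIV - {i})"] by auto
    have sub: "vec.subspace H" using H(1) by (simp add: hyperplane_def)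
    have "u = (\<Sum>j\<in>UNIV - {i}. c j *s w j)"
      unfolding c by (subst sum.remove[of UNIV i]) (simp_all add: \<open>c i = 0\<close>)
    also have "\<dots> \<in> H"
      using H by (intro vec.subspace_sum[OF sub] vec.subspace_scale[OF sub]) auto
    finally have "q \<subseteq> H" unfolding u using sub by (intro vec.span_minimal) auto
    moreover have "f j \<subseteq> H" if "j \<noteq> i" for j using in_hyp[OF H(1)] H(2) that by blast
    moreover have "\<Gamma> = insert q (range f)" using f q by (auto simp: bij_betw_def)
    ultimately have "p \<subseteq> H" if "p \<in> \<Gamma> - {f i}" for p
      using that by (metis DiffD1 DiffD2 insertE rangeE singleton_iff)
    hence "\<forall>p\<in>\<Gamma> - {f i}. p \<subseteq> H" by (intro ballI)
    moreover have "card (\<Gamma> - {f i}) = CARD('v)" using f_mem(1)[of i] fin card by simp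
    ultimately show False using no_hyp[of "\<Gamma> - {f i}" H] H(1) by blast
  qed
  define b where "b i = c i *s w i" for i
  have span_b: "vec.span {b i} = f i" for i
  proof -
    have "vec.span {c i *s w i} = vec.span {w i}"
      using c_nz[of i] by (intro vec.span_image_scale[of "{w i}" "\<lambda>_. c i", simplified]) auto
    thus ?thesis using w(2) by (simp add: b_def)
  qed
  define B where "B = (\<chi> k i. b i $ k)"
  have "vec.span (columns B) = UNIV"
  proof -
    have "b i \<in> columns B" for i
      by (auto simp: columns_def column_def B_def intro!: exI[of _ i])
    hence "b i \<in> vec.span (columns B)" for i by (simp add: vec.span_base)
    moreover have "w i = inverse (c i) *s b i" for i using c_nz[of i] by (simp add: b_def)
    ultimately have "range w \<subseteq> vec.span (columns B)" by (auto intro: vec.span_scale)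
    hence "vec.span (range w) \<subseteq> vec.span (columns B)" by (intro vec.span_minimal) auto
    thus ?thesis using span_w by auto
  qed
  then obtain A where A: "B ** A = Finite_Cartesian_Product.mat 1"
    using matrix_right_invertible_span_columns[of B] by auto
  hence A': "A ** B = Finite_Cartesian_Product.mat 1" using matrix_left_right_inverse by blast
  define l where "l i = A $ i" for i
  have "projective_frame \<Gamma> b l"
  proof
    show "\<Gamma> = insert (vec.span {\<Sum>i\<in>UNIV. b i}) (range (\<lambda>i. vec.span {b i}))"
      using f q u c unfolding span_b by (auto simp: bij_betw_def b_def)
    show "(\<Sum>k\<in>UNIV. l i $ k * b j $ k) = (if i = j then 1 else 0)" for i j
      using arg_cong[OF A', of "\<lambda>M. M $ i $ j"]
      by (simp add: matrix_matrix_mult_def l_def B_def Finite_Cartesian_Product.mat_def)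
    show "(\<Sum>i\<in>UNIV. b i $ k * l i $ k') = (if k = k' then 1 else 0)" for k k'
      using arg_cong[OF A, of "\<lambda>M. M $ k $ k'"]
      by (simp add: matrix_matrix_mult_def l_def B_def Finite_Cartesian_Product.mat_def)
  qed (rule four)
  thus ?thesis by blast
qed

section \<open>The ideal of the points\<close>

lemma subspace_defining_ideal: "ideal.subspace (defining_ideal \<Gamma>)"
  unfolding defining_ideal_def point_ideal_def by (intro ideal.subspace_Int) simp

text \<open>
  Polynomials all of whose homogeneous components vanish at \<open>v\<close> form an ideal, and it contains the
  generators of every point ideal with \<open>v \<in> p\<close>.
\<close>

lemma component_of_defining_ideal_vanishes:
  assumes "f \<in> defining_ideal \<Gamma>" "p \<in> \<Gamma>" "v \<in> p"
  shows "eval_mpoly (component d f) v = 0"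
proof -
  let ?Z = "{f. \<forall>d. eval_mpoly (component d f) v = 0}"
  have "eval_mpoly (component d (c * f)) v = 0" if "f \<in> ?Z" for c f d
    by (induction c rule: mpoly_induct) (use that in \<open>auto simp: component_monomial_mult distrib_right\<close>)
  hence "ideal.subspace ?Z" unfolding ideal.subspace_def by auto
  hence "point_ideal p \<subseteq> ?Z"
    unfolding point_ideal_def
    by (intro ideal.span_minimal) (use \<open>v \<in> p\<close> in \<open>auto simp: homogeneous_iff component_homogeneous\<close>)
  thus ?thesis using assms by (auto simp: defining_ideal_def)
qed

lemma homogeneous_in_defining_ideal:
  "homogeneous f \<Longrightarrow> (\<And>p v. p \<in> \<Gamma> \<Longrightarrow> v \<in> p \<Longrightarrow> eval_mpoly f v = 0) \<Longrightarrow> f \<in> defining_ideal \<Gamma>"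
  unfolding defining_ideal_def point_ideal_def by (auto intro!: ideal.span_base)

lemma component_in_defining_ideal:
  "f \<in> defining_ideal \<Gamma> \<Longrightarrow> component d f \<in> defining_ideal \<Gamma>"
  by (rule homogeneous_in_defining_ideal)
    (auto simp: homogeneous_iff intro: homogeneous_component component_of_defining_ideal_vanishes)

definition linear_form :: "'a ^ 'v \<Rightarrow> ('v::finite, 'a::comm_ring_1) mpoly" where
  "linear_form c = (\<Sum>k\<in>UNIV. monomial 0 (c $ k) * Var k)"

lemma homogeneous_linear_form: "homogeneous_of_degree 1 (linear_form c)"
  unfolding linear_form_def
  by (rule homogeneous_of_degree_sum) (auto simp: homogeneous_of_degree_def Var_def mult_single)

lemma eval_linear_form: "eval_mpoly (linear_form c) v = (\<Sum>k\<in>UNIV. c $ k * v $ k)"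
  by (simp add: linear_form_def)

lemma partial_deriv_linear_form: "partial_deriv k (linear_form c) = monomial 0 (c $ k)"
  by (simp add: linear_form_def partial_deriv_sum partial_deriv_mult partial_deriv_Var if_distrib
      cong: if_cong)

context projective_frame
begin

abbreviation J :: "('v, 'a) mpoly set" where "J \<equiv> defining_ideal \<Gamma>"

abbreviation L :: "'v \<Rightarrow> ('v, 'a) mpoly" where "L i \<equiv> linear_form (l i)"

abbreviation const :: "'a \<Rightarrow> ('v, 'a) mpoly" where "const \<equiv> monomial 0"

lemma eval_L_b: "eval_mpoly (L i) (b j) = (if i = j then 1 else 0)"
  by (simp add: eval_linear_form dual)

lemma eval_L_scale: "eval_mpoly (L i) (c *s v) = c * eval_mpoly (L i) v"
  by (simp add: eval_linear_form sum_distrib_left mult_ac)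

lemma eval_L_unit: "eval_mpoly (L i) (\<Sum>j\<in>UNIV. b j) = 1"
proof -
  have "eval_mpoly (L i) (\<Sum>j\<in>UNIV. b j) = (\<Sum>j\<in>UNIV. \<Sum>k\<in>UNIV. l i $ k * b j $ k)"
    unfolding eval_linear_form sum_component sum_distrib_left by (rule sum.swap)
  thus ?thesis by (simp add: dual)
qed

lemma Var_eq_sum_L: "Var k = (\<Sum>i\<in>UNIV. const (b i $ k) * L i)"
proof -
  have "(\<Sum>i\<in>UNIV. const (b i $ k) * L i) = (\<Sum>i\<in>UNIV. \<Sum>k'\<in>UNIV. const (b i $ k * l i $ k') * Var k')"
    by (simp add: linear_form_def sum_distrib_left mult_single flip: mult.assoc)
  also have "\<dots> = (\<Sum>k'\<in>UNIV. \<Sum>i\<in>UNIV. const (b i $ k * l i $ k') * Var k')"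
    by (rule sum.swap)
  also have "\<dots> = (\<Sum>k'\<in>UNIV. const (\<Sum>i\<in>UNIV. b i $ k * l i $ k') * Var k')"
  proof (rule sum.cong[OF refl])
    fix k'
    show "(\<Sum>i\<in>UNIV. const (b i $ k * l i $ k') * Var k') = const (\<Sum>i\<in>UNIV. b i $ k * l i $ k') * Var k'"
      by (simp add: monomial_sum sum_distrib_right)
  qed
  also have "\<dots> = (\<Sum>k'\<in>UNIV. if k = k' then Var k' else 0)"
    by (rule sum.cong) (simp_all add: resolution)
  finally show ?thesis by simp
qed

lemma irrelevant_ideal_eq_span_L: "irrelevant_ideal = ideal.span (range L)"
proof (rule equalityI)
  show "irrelevant_ideal \<subseteq> ideal.span (range L)"
    unfolding irrelevant_ideal_def
  proof (rule ideal.span_minimal)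
    have "Var k \<in> ideal.span (range L)" for k
      unfolding Var_eq_sum_L
      by (intro ideal.span_sum ideal.span_scale) (simp add: ideal.span_base)
    thus "range Var \<subseteq> ideal.span (range L)" by auto
  qed simp
  show "ideal.span (range L) \<subseteq> irrelevant_ideal"
  proof (rule ideal.span_minimal)
    have "L i \<in> ideal.span (range Var)" for i
      unfolding linear_form_def
      by (intro ideal.span_sum ideal.span_scale) (simp add: ideal.span_base)
    thus "range L \<subseteq> irrelevant_ideal" by (auto simp: irrelevant_ideal_def)
  qed (simp add: irrelevant_ideal_def)
qed

lemma L_in_irrelevant_ideal: "L i \<in> irrelevant_ideal"
  by (simp add: irrelevant_ideal_eq_span_L ideal.span_base)

lemma L_in_power_1: "L i \<in> ideal_power irrelevant_ideal 1"
proof -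
  have "ideal.subspace (irrelevant_ideal :: ('v, 'a) mpoly set)"
    by (simp add: irrelevant_ideal_def)
  thus ?thesis by (simp only: ideal_power_1 L_in_irrelevant_ideal)
qed

lemma homogeneous_quadric: "homogeneous_of_degree 2 (L i * L j - L k * L m)"
  using homogeneous_of_degree_mult[OF homogeneous_linear_form homogeneous_linear_form]
  by (intro homogeneous_of_degree_diff) (simp_all flip: one_add_one)

lemma quadric_in_J:
  assumes "i \<noteq> j" "k \<noteq> m"
  shows "L i * L j - L k * L m \<in> J"
proof (rule homogeneous_in_defining_ideal)
  show "homogeneous (L i * L j - L k * L m)"
    using homogeneous_quadric homogeneous_iff by blast
  fix p v assume "p \<in> \<Gamma>" "v \<in> p"
  then consider c where "v = c *s (\<Sum>j\<in>UNIV. b j)" | c n where "v = c *s b n"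
    by (auto simp: points vec.span_singleton)
  thus "eval_mpoly (L i * L j - L k * L m) v = 0"
    by cases (use assms in \<open>auto simp: eval_L_scale eval_L_unit eval_L_b\<close>)
qed

abbreviation words :: "nat \<Rightarrow> 'v list set" where "words d \<equiv> {vs. length vs = d}"

abbreviation word :: "'v list \<Rightarrow> ('v, 'a) mpoly" where "word vs \<equiv> prod_list (map L vs)"

lemma finite_words: "finite (words d)"
  using finite_lists_length_eq[of "UNIV :: 'v set" d] by simp

text \<open>
  Only that these combinations contain all homogeneous polynomials of degree \<open>d\<close> matters; words that
  differ by the order of their letters yield the same monomial, so the coefficients are not unique.
\<close>

definition forms :: "nat \<Rightarrow> ('v, 'a) mpoly set" where
  "forms d = {\<Sum>vs\<in>words d. const (c vs) * word vs | c. True}"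

lemma forms_sum:
  assumes "\<And>x. x \<in> A \<Longrightarrow> f x \<in> forms d"
  shows "(\<Sum>x\<in>A. const (a x) * f x) \<in> forms d"
proof -
  have add: "f + g \<in> forms d" if "f \<in> forms d" "g \<in> forms d" for f g
  proof -
    from that obtain c e where "f = (\<Sum>vs\<in>words d. const (c vs) * word vs)"
      "g = (\<Sum>vs\<in>words d. const (e vs) * word vs)" by (auto simp: forms_def)
    hence "f + g = (\<Sum>vs\<in>words d. const (c vs + e vs) * word vs)"
      by (simp add: single_add distrib_right sum.distrib)
    thus ?thesis by (auto simp: forms_def)
  qed
  have scale: "const a * f \<in> forms d" if "f \<in> forms d" for a f
  proof -
    from that obtain c where "f = (\<Sum>vs\<in>words d. const (c vs) * word vs)"
      by (auto simp: forms_def)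
    hence "const a * f = (\<Sum>vs\<in>words d. const (a * c vs) * word vs)"
      by (simp add: sum_distrib_left mult_single flip: mult.assoc)
    thus ?thesis by (auto simp: forms_def)
  qed
  have "0 \<in> forms d" by (auto simp: forms_def intro!: exI[of _ "\<lambda>_. 0"])
  thus ?thesis using assms
    by (induction A rule: infinite_finite_induct) (auto intro: add scale)
qed

lemma word_in_forms: "length vs = d \<Longrightarrow> word vs \<in> forms d"
  unfolding forms_def
  by (intro CollectI exI[of _ "\<lambda>ws. if ws = vs then 1 else 0"])
    (simp add: if_distrib[of const] if_distrib[of "\<lambda>c. c * _"] sum.delta[OF finite_words] cong: if_cong)

lemma L_mult_forms: "f \<in> forms d \<Longrightarrow> L i * f \<in> forms (Suc d)"
proof -
  assume "f \<in> forms d"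
  then obtain c where "f = (\<Sum>vs\<in>words d. const (c vs) * word vs)" by (auto simp: forms_def)
  hence "L i * f = (\<Sum>vs\<in>words d. const (c vs) * word (i # vs))"
    by (simp add: sum_distrib_left mult_ac)
  also have "\<dots> \<in> forms (Suc d)" by (intro forms_sum word_in_forms) simp
  finally show ?thesis .
qed

text \<open>
  Substitute each variable by its expression in the \<open>L i\<close>.
\<close>

lemma homogeneous_in_forms:
  assumes "homogeneous_of_degree d f"
  shows "f \<in> forms d"
proof -
  have "monomial m 1 \<in> forms d" if "mdeg m = d" for m
    using that
  proof (induction d arbitrary: m)
    case 0
    thus ?case using word_in_forms[of "[]" 0] by (simp add: mdeg_eq_0_iff)
  next
    case (Suc d)
    then obtain k m' where m: "m = Poly_Mapping.single k 1 + m'"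
      by (metis split_off_variable zero_less_Suc)
    hence "monomial m 1 = (\<Sum>i\<in>UNIV. const (b i $ k) * (L i * monomial m' 1))"
      unfolding m monomial_add_eq_Var_mult Var_eq_sum_L by (simp add: sum_distrib_right mult.assoc)
    also have "\<dots> \<in> forms (Suc d)"
      by (intro forms_sum L_mult_forms Suc.IH) (use Suc.prems m in simp)
    finally show ?case .
  qed
  hence "(\<Sum>m\<in>Poly_Mapping.keys f. const (mcoeff f m) * monomial m 1) \<in> forms d"
    using assms by (intro forms_sum) (simp add: homogeneous_of_degree_def)
  also have "(\<Sum>m\<in>Poly_Mapping.keys f. const (mcoeff f m) * monomial m 1) = f"
    by (subst (3) mpoly_as_sum) (simp add: mult_single)
  finally show ?thesis .
qed

lemma variable_outside_list: "\<exists>v. v \<notin> set vs" if "length vs \<le> 3" for vs :: "'v list"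
proof (rule ccontr)
  assume "\<not> (\<exists>v. v \<notin> set vs)"
  hence "set vs = UNIV" by auto
  hence "CARD('v) \<le> length vs" using card_length[of vs] by simp
  thus False using that four_variables by simp
qed

text \<open>
  With a third index \<open>w\<close>, both \<open>L\<^sub>i L\<^sub>r L\<^sub>p\<close> and \<open>L\<^sub>k L\<^sub>r L\<^sub>p\<close> are congruent to \<open>L\<^sub>i L\<^sub>k L\<^sub>w\<close> modulo quadrics of
  \<open>J\<close> times linear forms.
\<close>

lemma exchange_factor:
  assumes "r \<noteq> p"
  shows "(L i - L k) * (L r * L p) \<in> ideal_mult J (ideal_power irrelevant_ideal 1)"
proof -
  let ?N = "ideal_mult J (ideal_power irrelevant_ideal 1)"
  obtain w where w: "w \<noteq> i" "w \<noteq> k" using variable_outside_list[of "[i, k]"] by auto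
  have "(L r * L p - L k * L w) * L i \<in> ?N" "(L r * L p - L i * L w) * L k \<in> ?N"
    using assms w by (auto intro!: ideal_multI quadric_in_J L_in_power_1 simp del: ideal_power.simps One_nat_def)
  hence "(L r * L p - L k * L w) * L i - (L r * L p - L i * L w) * L k \<in> ?N"
    by (intro ideal.subspace_diff subspace_ideal_mult)
  thus ?thesis by (simp add: algebra_simps)
qed

text \<open>
  Replace the two distinct letters by \<open>r\<close> and \<open>p\<close>, then exchange the remaining letters for \<open>r\<close>
  one at a time.
\<close>

lemma mixed_words_congruent:
  assumes "i \<noteq> j" "r \<noteq> p"
  shows "word us * (L i * L j) - L r ^ length us * (L r * L p)
       \<in> ideal_mult J (ideal_power irrelevant_ideal (length us))"
proof -
  have "(word us - L r ^ length us) * (L r * L p)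
       \<in> ideal_mult J (ideal_power irrelevant_ideal (length us))"
  proof (induction us)
    case Nil
    show ?case by (simp add: ideal.subspace_0)
  next
    case (Cons u us)
    have pow: "L r ^ e \<in> ideal_power irrelevant_ideal e" for e
      using prod_list_in_ideal_power[of "replicate e (L r)" irrelevant_ideal]
        L_in_irrelevant_ideal by (simp add: prod_list_replicate set_replicate_conv_if)
    from ideal_mult_power_add[OF Cons.IH L_in_power_1]
    have "L u * ((word us - L r ^ length us) * (L r * L p))
        \<in> ideal_mult J (ideal_power irrelevant_ideal (length us + 1))" .
    moreover have "L r ^ length us * ((L u - L r) * (L r * L p))
        \<in> ideal_mult J (ideal_power irrelevant_ideal (1 + length us))"
      by (rule ideal_mult_power_add[OF exchange_factor[OF assms(2)] pow])
    ultimately have "L u * ((word us - L r ^ length us) * (L r * L p))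
        + L r ^ length us * ((L u - L r) * (L r * L p))
        \<in> ideal_mult J (ideal_power irrelevant_ideal (length (u # us)))"
      by (intro ideal.subspace_add subspace_ideal_mult) simp_all
    thus ?case by (simp add: algebra_simps)
  qed
  moreover have "(L i * L j - L r * L p) * word us
      \<in> ideal_mult J (ideal_power irrelevant_ideal (length us))"
    using prod_list_in_ideal_power[of "map L us" irrelevant_ideal] L_in_irrelevant_ideal
    by (intro ideal_multI quadric_in_J assms) auto
  ultimately have "(L i * L j - L r * L p) * word us + (word us - L r ^ length us) * (L r * L p)
      \<in> ideal_mult J (ideal_power irrelevant_ideal (length us))"
    by (intro ideal.subspace_add subspace_ideal_mult)
  thus ?thesis by (simp add: algebra_simps)
qed

lemma word_remove1: "j \<in> set vs \<Longrightarrow> word vs = L j * word (remove1 j vs)"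
  by (induction vs) (auto simp: mult_ac)

lemma constant_or_mixed_word:
  obtains i where "vs = replicate (length vs) i"
  | i j us where "i \<noteq> j" "word vs = word us * (L i * L j)" "length vs = length us + 2"
proof (cases vs)
  case Nil
  thus ?thesis using that(1) by simp
next
  case (Cons i ws)
  show ?thesis
  proof (cases "set ws \<subseteq> {i}")
    case True
    hence "vs = replicate (length vs) i"
      using Cons by (intro replicate_length_same[symmetric]) auto
    thus ?thesis by (rule that(1))
  next
    case False
    then obtain j where j: "j \<in> set ws" "j \<noteq> i" by auto
    have "word ws = L j * word (remove1 j ws)"
      by (rule word_remove1[OF j(1)])
    hence "word vs = word (remove1 j ws) * (L i * L j)" by (simp add: Cons mult_ac)
    moreover have "length vs = length (remove1 j ws) + 2"
      using j(1) Cons length_pos_if_in_set[OF j(1)] by (simp add: length_remove1)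
    ultimately show ?thesis by (rule that(2)[OF j(2)[symmetric]])
  qed
qed

lemma eval_word_b: "eval_mpoly (word vs) (b i) = (if set vs \<subseteq> {i} then 1 else 0)"
  by (induction vs) (auto simp: eval_L_b)

lemma eval_word_unit: "eval_mpoly (word vs) (\<Sum>j\<in>UNIV. b j) = 1"
  by (induction vs) (auto simp: eval_L_unit)

text \<open>
  Expand \<open>f\<close> in words. Vanishing at \<open>b i\<close> kills the coefficient of the power \<open>L\<^sub>i\<^sup>d\<close>. All other words are
  mixed, hence congruent to one fixed word \<open>\<tau>\<close>, and vanishing at the unit point says that the
  coefficients sum to zero. The result says that \<open>J\<close> is generated by its quadrics, in the graded form
  in which it is needed.
\<close>

lemma homogeneous_in_J:
  assumes f: "f \<in> J" "homogeneous_of_degree d f"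
  shows "f \<in> ideal_mult J (ideal_power irrelevant_ideal (d - 2))" and "d < 2 \<Longrightarrow> f = 0"
proof -
  obtain c where c: "f = (\<Sum>vs\<in>words d. const (c vs) * word vs)"
    using homogeneous_in_forms[OF f(2)] by (auto simp: forms_def)
  have vanish: "eval_mpoly f v = 0" if "p \<in> \<Gamma>" "v \<in> p" for p v
    using component_of_defining_ideal_vanishes[OF f(1) that, of d] component_homogeneous[OF f(2), of d]
    by simp
  have c_replicate: "c (replicate d i) = 0" for i
  proof -
    have "0 = eval_mpoly f (b i)"
      using vanish[of "vec.span {b i}"] by (simp add: points vec.span_base)
    also have "\<dots> = (\<Sum>vs\<in>words d. if vs = replicate d i then c vs else 0)"
    proof -
      have "set vs \<subseteq> {i} \<longleftrightarrow> vs = replicate d i" if "vs \<in> words d" for vs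
      proof
        assume "set vs \<subseteq> {i}"
        thus "vs = replicate d i" using that by (intro replicate_eqI) auto
      next
        assume "vs = replicate d i"
        hence "set vs = set (replicate d i)" by (rule arg_cong)
        thus "set vs \<subseteq> {i}" by (simp add: set_replicate_conv_if split: if_splits)
      qed
      thus ?thesis unfolding c by (simp add: eval_word_b if_distrib cong: if_cong)
    qed
    also have "\<dots> = c (replicate d i)"
      by (simp add: sum.delta[OF finite_words])
    finally show ?thesis by simp
  qed
  have c_sum: "(\<Sum>vs\<in>words d. c vs) = 0"
  proof -
    have "0 = eval_mpoly f (\<Sum>j\<in>UNIV. b j)"
      using vanish[of "vec.span {\<Sum>j\<in>UNIV. b j}"] by (simp add: points vec.span_base)
    thus ?thesis unfolding c by (simp add: eval_word_unit)
  qed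
  obtain r p :: 'v where op: "r \<noteq> p" using variable_outside_list[of "[undefined]"] by auto
  define \<tau> where "\<tau> = L r ^ (d - 2) * (L r * L p)"
  have "const (c vs) * (word vs - \<tau>) \<in> ideal_mult J (ideal_power irrelevant_ideal (d - 2))"
    if "vs \<in> words d" for vs
  proof (cases vs rule: constant_or_mixed_word)
    case (1 i)
    hence "c vs = 0" using c_replicate[of i] that by simp
    thus ?thesis by (simp add: ideal.subspace_0)
  next
    case (2 i j us)
    hence "d - 2 = length us" using that by simp
    thus ?thesis
      using mixed_words_congruent[OF 2(1) op, of us] 2(2)
      by (intro ideal.subspace_scale subspace_ideal_mult) (simp add: \<tau>_def)
  qed
  hence "(\<Sum>vs\<in>words d. const (c vs) * (word vs - \<tau>)) \<in> ideal_mult J (ideal_power irrelevant_ideal (d - 2))"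
    by (intro ideal.subspace_sum subspace_ideal_mult)
  also have "(\<Sum>vs\<in>words d. const (c vs) * (word vs - \<tau>)) = f - (\<Sum>vs\<in>words d. const (c vs)) * \<tau>"
    unfolding c by (simp add: right_diff_distrib sum_subtractf sum_distrib_right)
  also have "(\<Sum>vs\<in>words d. const (c vs)) = const (\<Sum>vs\<in>words d. c vs)"
    by (rule monomial_sum[symmetric])
  finally show "f \<in> ideal_mult J (ideal_power irrelevant_ideal (d - 2))"
    by (simp add: c_sum)
  show "f = 0" if "d < 2"
    unfolding c
  proof (rule sum.neutral, rule ballI)
    fix vs assume "vs \<in> words d"
    thus "const (c vs) * word vs = 0"
      using that c_replicate by (cases vs rule: constant_or_mixed_word) auto
  qed
qed

lemma J_order:
  assumes "2 \<le> d"
  shows "J \<inter> ideal_power irrelevant_ideal d \<subseteq> ideal_mult J (ideal_power irrelevant_ideal (d - 2))"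
proof
  fix f assume f: "f \<in> J \<inter> ideal_power irrelevant_ideal d"
  have "component e f \<in> ideal_mult J (ideal_power irrelevant_ideal (d - 2))" for e
  proof (cases "d \<le> e")
    case True
    have "component e f \<in> ideal_mult J (ideal_power irrelevant_ideal (e - 2))"
      using f by (intro homogeneous_in_J component_in_defining_ideal homogeneous_component) auto
    moreover have "e - 2 = (d - 2) + (e - d)" using True assms by simp
    ultimately show ?thesis
      using ideal_mult_mono[OF ideal_power_antimono] by (metis subsetD)
  next
    case False
    have "component e f = 0"
      using f False by (intro poly_mapping_eqI)
        (auto simp: coeff_component irrelevant_ideal_power in_keys_iff)
    thus ?thesis by (simp add: ideal.subspace_0)
  qed
  thus "f \<in> ideal_mult J (ideal_power irrelevant_ideal (d - 2))"
    using mpoly_as_sum_of_components[of f] ideal.subspace_sum[OF subspace_ideal_mult] by metis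
qed

lemma degrees_in_J:
  assumes "f \<in> J" "m \<in> Poly_Mapping.keys f"
  shows "2 \<le> mdeg m"
proof (rule ccontr)
  assume "\<not> 2 \<le> mdeg m"
  hence "component (mdeg m) f = 0"
    by (intro homogeneous_in_J(2)[OF _ homogeneous_component] component_in_defining_ideal assms(1)) simp
  hence "mcoeff f m = 0" using coeff_component[of "mdeg m" f m] by simp
  thus False using assms(2) by (simp add: in_keys_iff)
qed

text \<open>
  Since \<open>J\<close> has no elements of degree below two, only the constant term of the factor contributes.
\<close>

lemma component_2_mult:
  assumes "g \<in> J"
  shows "component 2 (r * g) = const (mcoeff r 0) * component 2 g"
proof (induction r rule: mpoly_induct)
  case (monomial m a)
  have "component e g = 0" if "e < 2" for e
    using that assms by (intro homogeneous_in_J(2)[OF _ homogeneous_component] component_in_defining_ideal)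
  moreover have "2 - mdeg m < 2" if "m \<noteq> 0"
    using mdeg_eq_0_iff[of m] that by linarith
  ultimately show ?case
    by (cases "m = 0") (auto simp: component_monomial_mult lookup_single)
qed (simp_all add: lookup_add single_add distrib_right)

section \<open>Minors of the Jacobian matrix\<close>

context
  fixes G :: "('v, 'a) mpoly set"
  assumes G: "finite G" "\<And>g. g \<in> G \<Longrightarrow> homogeneous g" "ideal.span G = J"
begin

lemma G_subset_J: "G \<subseteq> J"
  using G(3) ideal.span_superset by blast

text \<open>
  Compare quadratic components in an expansion of \<open>q\<close> over the generators: the coefficients become
  constants, which is what makes the gradient of \<open>q\<close> a constant combination of the rows of the
  Jacobian matrix.
\<close>

lemma quadric_scalar_combination:
  assumes "q \<in> J" "homogeneous_of_degree 2 q"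
  shows "\<exists>c. q = (\<Sum>g\<in>G. const (c g) * g)"
proof -
  have "q \<in> ideal.span G" using assms G by simp
  then obtain r where r: "q = (\<Sum>g\<in>G. r g * g)"
    using ideal.span_finite[OF G(1)] by auto
  have "q = component 2 q" using component_homogeneous[OF assms(2), of 2] by simp
  also have "\<dots> = (\<Sum>g\<in>G. const (mcoeff (r g) 0) * component 2 g)"
    unfolding r component_sum using G_subset_J by (intro sum.cong component_2_mult) auto
  also have "\<dots> = (\<Sum>g\<in>G. const (if component 2 g = 0 then 0 else mcoeff (r g) 0) * g)"
  proof (rule sum.cong[OF refl])
    fix g assume "g \<in> G"
    then obtain e where "homogeneous_of_degree e g" using G(2) homogeneous_iff by blast
    thus "const (mcoeff (r g) 0) * component 2 g
        = const (if component 2 g = 0 then 0 else mcoeff (r g) 0) * g"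
      by (auto simp: component_homogeneous)
  qed
  finally show ?thesis
    by (intro exI[of _ "\<lambda>g. if component 2 g = 0 then 0 else mcoeff (r g) 0"])
qed

lemma jacobian_subset: "jacobian_minors_ideal t G \<subseteq> ideal_power irrelevant_ideal t"
  unfolding jacobian_minors_ideal_def minors_ideal_def
proof (rule ideal.span_minimal[OF _ subspace_ideal_power], rule subsetI)
  fix x assume "x \<in> minors t G UNIV (\<lambda>g i. partial_deriv i g)"
  then obtain rs cs where x: "x = det_of t (\<lambda>i j. partial_deriv (cs ! j) (rs ! i))"
    and rs: "length rs = t" "set rs \<subseteq> G"
    by (auto simp: minors_def det_of_def)
  show "x \<in> ideal_power irrelevant_ideal t"
    unfolding x
  proof (rule det_of_in_ideal_power)
    fix i j assume "i < t"
    hence "rs ! i \<in> set rs" using rs by simp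
    hence "rs ! i \<in> J" using rs G_subset_J by blast
    thus "partial_deriv (cs ! j) (rs ! i) \<in> irrelevant_ideal"
      by (intro partial_deriv_in_irrelevant_ideal degrees_in_J)
  qed
qed

text \<open>
  Multiplying a gradient by the matrix of the basis \<open>b\<close> expresses it in the adapted coordinates.
\<close>

lemma edge_row_eq_gradient:
  "edge_row L i j s = (\<Sum>v\<in>UNIV. partial_deriv v (L i * L j) * const (b s $ v))"
proof -
  have dual': "(\<Sum>v\<in>UNIV. const (l i $ v * b s $ v)) = (if i = s then 1 else 0)" for i
    by (simp add: dual flip: monomial_sum)
  have "(\<Sum>v\<in>UNIV. partial_deriv v (L i * L j) * const (b s $ v))
      = (\<Sum>v\<in>UNIV. const (l i $ v * b s $ v) * L j + const (l j $ v * b s $ v) * L i)"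
    by (simp add: partial_deriv_mult partial_deriv_linear_form algebra_simps mult_single
        flip: mult.assoc[of _ "const _"])
  also have "\<dots> = (\<Sum>v\<in>UNIV. const (l i $ v * b s $ v)) * L j + (\<Sum>v\<in>UNIV. const (l j $ v * b s $ v)) * L i"
    by (simp add: sum.distrib sum_distrib_right)
  finally show ?thesis by (auto simp: edge_row_def dual')
qed

lemma difference_row_minors:
  assumes "range qs \<subseteq> edge_pairs UNIV"
  shows "det_of t (\<lambda>i j. difference_row L (qs i) (cs j)) \<in> jacobian_minors_ideal t G"
proof -
  define quadric where "quadric = (\<lambda>((i, j), (k, m)). L i * L j - L k * L m)"
  have "\<exists>c. quadric (qs i) = (\<Sum>g\<in>G. const (c g) * g)" for i
  proof (rule quadric_scalar_combination)
    have "qs i \<in> edge_pairs UNIV" using assms by auto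
    then obtain i' j k m where "qs i = ((i', j), (k, m))" "i' \<noteq> j" "k \<noteq> m"
      by (auto simp: edge_pairs_def)
    thus "quadric (qs i) \<in> J" "homogeneous_of_degree 2 (quadric (qs i))"
      by (simp_all add: quadric_def quadric_in_J homogeneous_quadric)
  qed
  from choice[OF allI[OF this]]
  obtain c where c: "\<forall>i. quadric (qs i) = (\<Sum>g\<in>G. const (c i g) * g)" by (rule exE)
  show ?thesis
    unfolding jacobian_minors_ideal_def
  proof (rule det_of_combined_matrix_in_minors_ideal[OF G(1) finite])
    fix i j
    have "difference_row L (qs i) (cs j) = (\<Sum>v\<in>UNIV. partial_deriv v (quadric (qs i)) * const (b (cs j) $ v))"
      by (simp add: difference_row_def quadric_def edge_row_eq_gradient left_diff_distrib sum_subtractf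
          split: prod.split)
    also have "\<dots> = (\<Sum>v\<in>UNIV. \<Sum>g\<in>G. const (c i g) * partial_deriv v g * const (b (cs j) $ v))"
      by (simp add: c[rule_format] partial_deriv_sum partial_deriv_mult sum_distrib_right)
    also have "\<dots> = (\<Sum>g\<in>G. \<Sum>v\<in>UNIV. const (c i g) * partial_deriv v g * const (b (cs j) $ v))"
      by (rule sum.swap)
    finally show "difference_row L (qs i) (cs j) = \<dots>" .
  qed
qed

lemma jacobian_minors_ideal_eq:
  assumes "CARD('v) = Suc t"
  shows "jacobian_minors_ideal t G = ideal_power irrelevant_ideal t"
proof (rule antisym[OF jacobian_subset])
  show "ideal_power irrelevant_ideal t \<subseteq> jacobian_minors_ideal t G"
    unfolding irrelevant_ideal_eq_span_L
  proof (rule ideal_power_span_subsetI)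
    show sub: "ideal.subspace (jacobian_minors_ideal t G)"
      by (simp add: jacobian_minors_ideal_def minors_ideal_def)
    fix fs assume fs: "length fs = t" "set fs \<subseteq> range L"
    have "\<exists>vs. fs = map L vs"
      unfolding ex_map_conv using fs(2) by blast
    then obtain vs where vs: "fs = map L vs" ..
    show "prod_list fs \<in> jacobian_minors_ideal t G"
      unfolding vs
      by (rule monomials_from_difference_row_minors[where X = UNIV and m = t, OF sub])
        (use fs vs assms four_variables in \<open>auto intro: difference_row_minors\<close>)
  qed
qed

end
end

section \<open>The ideal of Jacobian minors and torsion-freeness\<close>

theorem proposition4p1:
  fixes n :: nat
    and \<Gamma> :: "('a::alg_closed_field ^ 'v::finite) set set"
    and G :: "('v, 'a) mpoly set"
  assumes "CARD('v) = n + 1" and "n \<ge> 3"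
    and "\<Gamma> \<subseteq> projective_points" and "card \<Gamma> = n + 2"
    and "general_linear_position \<Gamma>"
    and "minimal_homogeneous_generators G (defining_ideal \<Gamma>)"
  shows "jacobian_minors_ideal n G = ideal_power irrelevant_ideal n \<and>
         aluffi_torsion_free (defining_ideal \<Gamma>)
           (ideal.span (defining_ideal \<Gamma> \<union> jacobian_minors_ideal n G))"
proof -
  have "\<exists>b l. projective_frame \<Gamma> b l"
    by (rule general_linear_position_frame[OF assms(5)]) (use assms(1,2,4) in simp_all)
  then obtain b l where "projective_frame \<Gamma> b l" by blast
  then interpret projective_frame \<Gamma> b l .
  have eq: "jacobian_minors_ideal n G = ideal_power irrelevant_ideal n"
    using assms(1,6) by (intro jacobian_minors_ideal_eq)
      (auto simp: minimal_homogeneous_generators_def)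
  moreover have "aluffi_torsion_free J (ideal.span (J \<union> ideal_power irrelevant_ideal n))"
    using assms(2) by (intro aluffi_torsion_free_add_power subspace_defining_ideal J_order) auto
  ultimately show ?thesis by simp
qed

end
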